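(* Let $(T,d)$ be a metric space and $m$ a Borel probability measure on $T$ with $\operatorname{supp}(m)=T$. Let $a,b\ge0$, let $\varphi\in\mathcal{G}_{a,b}$ be a Young function, and let $R\ge 2$. Put $A=\frac{R^3}{(R-1)(R-2)}$ and $B=\frac{R^2}{R-1}$. Then for each separable real-valued stochastic process $X(t)$, $t\in T$, which satisfies $$\sup_{s,t\in T}\mathbf{E}\,\varphi\left(\frac{|X(s)-X(t)|}{d(s,t)}\right)\le 1,$$ the following inequality holds: $$\mathbf{E}\sup_{s,t\in T}|X(s)-X(t)|\le 2aA\,\mathcal{S}+2bB\,\bar{\mathcal{S}}.$$
   Context: $B(x,\varepsilon)=\{y\in T:d(x,y)\le\varepsilon\}$ is the closed ball and $D(T)=\sup\{d(s,t):s,t\in T\}$ the diameter of $T$ (possibly $+\infty$). A Young function is a (strictly) increasing convex function $\varphi:\mathbb{R}_+\to\mathbb{R}$ with $\varphi(0)=0$. For $a,b\ge0$, $\mathcal{G}_{a,b}$ is the class of all functions $\varphi:\mathbb{R}_+\to\mathbb{R}$ that are (strictly) increasing and continuous, satisfy $\varphi(0)=0$, and satisfy $x\le a+b\frac{\varphi(xy)}{\varphi(y)}$ for all $x\ge 0$, $y\ge\varphi^{-1}(1)$; it is understood that the inverse $\varphi^{-1}$ is defined on $[0,\infty)$. Define $\sigma(x)=\int_0^{D(T)}\varphi^{-1}\left(\frac{1}{m(B(x,\varepsilon))}\right)d\varepsilon\in[0,\infty]$, $\bar{\mathcal{S}}=\int_T\sigma(u)\,m(du)\in[0,\infty]$ and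 $\mathcal{S}=\sup_{x\in T}\sigma(x)\in[0,\infty]$. Conventions: $0/0=0$ (so the terms with $s=t$ contribute $\varphi(0)=0$); for $R=2$, $A=+\infty$; and $0\cdot\infty=0$. For a separable process, expectations of suprema over $T$ are understood as suprema over finite subsets: $\mathbf{E}\sup_{s,t\in T}|X(s)-X(t)|:=\sup_{F\subset T,\ F\text{ finite}}\mathbf{E}\sup_{s,t\in F}|X(s)-X(t)|$. *)

theory Defs
  imports "HOL-Probability.Probability"
begin

text \<open>Functions on \<open>\<real>\<^sub>+ = [0,\<infinity>)\<close> are represented by functions on \<^typ>\<open>real\<close>
  of which only the values on \<open>{0..}\<close> matter.\<close>

definition young_function :: "(real \<Rightarrow> real) \<Rightarrow> bool" where
  "young_function \<phi> \<longleftrightarrow>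
     strict_mono_on {0..} \<phi> \<and> convex_on {0..} \<phi> \<and> \<phi> 0 = 0"

definition phi_inv :: "(real \<Rightarrow> real) \<Rightarrow> real \<Rightarrow> real" where
  "phi_inv \<phi> = inv_into {0..} \<phi>"

text \<open>The surjectivity condition \<open>\<phi> ` {0..} = {0..}\<close> says that the inverse is defined
  on all of \<open>[0,\<infinity>)\<close>.\<close>

definition class_G :: "real \<Rightarrow> real \<Rightarrow> (real \<Rightarrow> real) set" where
  "class_G a b = {\<phi>.
     strict_mono_on {0..} \<phi> \<and> continuous_on {0..} \<phi> \<and> \<phi> 0 = 0 \<and> \<phi> ` {0..} = {0..} \<and>
     (\<forall>x\<ge>0. \<forall>y\<ge>phi_inv \<phi> 1. x \<le> a + b * (\<phi> (x * y) / \<phi> y))}"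

definition measure_support :: "'a::topological_space measure \<Rightarrow> 'a set" where
  "measure_support m = {x. \<forall>U. open U \<and> x \<in> U \<longrightarrow> emeasure m U > 0}"

text \<open>Unlike the library's \<^const>\<open>diameter\<close>, which is \<open>0\<close> on unbounded sets, this takes the
  value \<open>\<infinity>\<close> there.\<close>

definition ediameter :: "'a::metric_space set \<Rightarrow> ennreal" where
  "ediameter S = (SUP s\<in>S. SUP t\<in>S. ennreal (dist s t))"

text \<open>In the following the metric space \<open>T\<close> is the whole type.  The integral over
  \<open>[0, D(T)]\<close> is taken over \<open>{\<epsilon>. 0 < \<epsilon> \<and> \<epsilon> < D(T)}\<close>, which also makes sense for
  \<open>D(T) = \<infinity>\<close> and avoids \<open>\<epsilon> = 0\<close>, where the ball may be a null set.\<close>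

definition mm_sigma :: "(real \<Rightarrow> real) \<Rightarrow> 'a::metric_space measure \<Rightarrow> 'a \<Rightarrow> ennreal" where
  "mm_sigma \<phi> m x =
     (\<integral>\<^sup>+\<epsilon>\<in>{\<epsilon>. 0 < \<epsilon> \<and> ennreal \<epsilon> < ediameter (UNIV :: 'a set)}.
        ennreal (phi_inv \<phi> (1 / measure m (cball x \<epsilon>))) \<partial>lborel)"

definition mm_S_bar :: "(real \<Rightarrow> real) \<Rightarrow> 'a::metric_space measure \<Rightarrow> ennreal" where
  "mm_S_bar \<phi> m = (\<integral>\<^sup>+u. mm_sigma \<phi> m u \<partial>m)"

definition mm_S :: "(real \<Rightarrow> real) \<Rightarrow> 'a::metric_space measure \<Rightarrow> ennreal" where
  "mm_S \<phi> m = (SUP x. mm_sigma \<phi> m x)"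

text \<open>Separability of a process: for some countable \<open>S\<close>, almost surely every \<open>X(t)\<close> is a limit
  point of the values \<open>X(s)\<close> as \<open>s \<rightarrow> t\<close> in \<open>S\<close> (where \<open>s = t\<close> is allowed).\<close>

definition separable_process ::
    "'w measure \<Rightarrow> ('a::metric_space \<Rightarrow> 'w \<Rightarrow> real) \<Rightarrow> bool" where
  "separable_process M X \<longleftrightarrow>
     (\<exists>S. countable S \<and>
        (AE \<omega> in M. \<forall>t. \<forall>\<epsilon>>0. X t \<omega> \<in> closure ((\<lambda>s. X s \<omega>) ` (S \<inter> ball t \<epsilon>))))"

definition expected_sup_increment ::
    "'w measure \<Rightarrow> ('a \<Rightarrow> 'w \<Rightarrow> real) \<Rightarrow> ennreal" where
  "expected_sup_increment M X =
     (SUP F\<in>{F. finite F}. \<integral>\<^sup>+\<omega>. (SUP s\<in>F. SUP t\<in>F. ennreal \<bar>X s \<omega> - X t \<omega>\<bar>) \<partial>M)"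

end

theory Submission
  imports Defs
begin

text \<open>Let \<open>y\<^sub>k = \<phi>\<^sup>-\<^sup>1(1) R\<^sup>k\<close>, let \<open>r\<^sub>k(x)\<close> be the smallest radius whose ball around \<open>x\<close> has measure
  at least \<open>1 / \<phi>(y\<^sub>k)\<close>, and let \<open>P\<^sub>k\<close> average a function over the ball of radius \<open>r\<^sub>k\<close>; \<open>P\<^sub>0\<close> averages
  over all of \<open>T\<close>.  Walking from \<open>s\<close> by \<open>P\<^sub>n, P\<^sub>n\<^sub>-\<^sub>1, \<dots>, P\<^sub>0\<close> ends in a point \<open>u\<close> distributed
  according to \<open>m\<close>, so the triangle inequality bounds the mean of \<open>|X(s) - X(u)|\<close> by the sum of the
  mean steps, and the same \<open>u\<close> serves for \<open>t\<close>.  A step from \<open>u\<close> to \<open>v\<close> at level \<open>k\<close> is at most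
  \<open>r\<^sub>k(u) y\<^sub>k\<^sub>+\<^sub>1 (a + b \<phi>(|X(u) - X(v)| / d(u,v)) / \<phi>(y\<^sub>k\<^sub>+\<^sub>1))\<close>.  In the second term the factor
  \<open>1 / \<phi>(y\<^sub>k\<^sub>+\<^sub>1)\<close> cancels the density of \<open>P\<^sub>k\<^sub>+\<^sub>1\<close>, which leaves an integral over \<open>T\<close> that does not depend
  on \<open>s\<close>.  The first term is controlled through the fact that \<open>r\<^sub>k\<close> is 1-Lipschitz, and the radii are
  compared with \<open>\<sigma>\<close> by \<open>\<Sum>\<^sub>k (1 - 1 / R) y\<^sub>k r\<^sub>k \<le> \<sigma>\<close>.  As \<open>n\<close> grows, the initial error vanishes
  in mean because \<open>X\<close> is Lipschitz in mean and \<open>r\<^sub>n \<longlonglongrightarrow> 0\<close>.\<close>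

section \<open>Chaining along Markov kernels\<close>

locale markov_kernels = prob_space m for m :: "'a measure" +
  fixes p :: "nat \<Rightarrow> 'a \<Rightarrow> 'a \<Rightarrow> ennreal"
  assumes kernel_measurable [measurable]:
      "\<And>k. case_prod (p k) \<in> borel_measurable (m \<Otimes>\<^sub>M m)"
    and space_eq_UNIV [simp]: "space m = UNIV"
    and kernel_total: "\<And>k x. (\<integral>\<^sup>+u. p k x u \<partial>m) = 1"
    and kernel_0: "\<And>x u. p 0 x u = 1"
begin

definition local_osc :: "('a \<Rightarrow> real) \<Rightarrow> nat \<Rightarrow> 'a \<Rightarrow> ennreal" where
  "local_osc f k x = (\<integral>\<^sup>+u. p k x u * ennreal \<bar>f x - f u\<bar> \<partial>m)"

fun chain_osc :: "('a \<Rightarrow> real) \<Rightarrow> nat \<Rightarrow> 'a \<Rightarrow> ennreal" where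
  "chain_osc f 0 x = 0"
| "chain_osc f (Suc n) x =
     (\<integral>\<^sup>+u. p (Suc n) x u * (local_osc f n u + chain_osc f n u) \<partial>m)"

lemma kernel_section_measurable [measurable]: "p k x \<in> borel_measurable m"
  using measurable_compose[OF measurable_Pair1'[of x m m] kernel_measurable[of k]] by simp

lemma local_osc_measurable [measurable]:
  assumes [measurable]: "f \<in> borel_measurable m"
  shows "local_osc f k \<in> borel_measurable m"
  unfolding local_osc_def by measurable

lemma chain_osc_measurable [measurable]:
  assumes [measurable]: "f \<in> borel_measurable m"
  shows "chain_osc f n \<in> borel_measurable m"
proof (induction n)
  case 0
  then show ?case by simp
next
  case (Suc n)
  note [measurable] = Suc.IH
  show ?case by simp
qed

lemma kernel_integral_const: "(\<integral>\<^sup>+u. p k x u * c \<partial>m) = c"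
  by (simp add: nn_integral_multc kernel_total)

lemma integral_osc_le_chain:
  fixes f :: "'a \<Rightarrow> real"
  assumes [measurable]: "f \<in> borel_measurable m"
  shows "(\<integral>\<^sup>+u. ennreal \<bar>f x - f u\<bar> \<partial>m) \<le> local_osc f n x + chain_osc f n x"
proof (induction n arbitrary: x)
  case 0
  then show ?case by (simp add: local_osc_def kernel_0)
next
  case (Suc n)
  define G where "G x = (\<integral>\<^sup>+u. ennreal \<bar>f x - f u\<bar> \<partial>m)" for x
  have [measurable]: "G \<in> borel_measurable m"
    unfolding G_def by measurable
  have tri: "G x \<le> ennreal \<bar>f x - f v\<bar> + G v" for v
  proof -
    have "G x \<le> (\<integral>\<^sup>+u. ennreal \<bar>f x - f v\<bar> + ennreal \<bar>f v - f u\<bar> \<partial>m)"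
      unfolding G_def
      by (intro nn_integral_mono) (auto simp flip: ennreal_plus intro!: ennreal_leI)
    also have "\<dots> = ennreal \<bar>f x - f v\<bar> + G v"
      by (simp add: nn_integral_add G_def emeasure_space_1[simplified])
    finally show ?thesis .
  qed
  have "G x = (\<integral>\<^sup>+v. p (Suc n) x v * G x \<partial>m)"
    by (simp add: kernel_integral_const)
  also have "\<dots> \<le> (\<integral>\<^sup>+v. p (Suc n) x v * (ennreal \<bar>f x - f v\<bar> + G v) \<partial>m)"
    by (intro nn_integral_mono mult_left_mono tri) auto
  also have "\<dots> = local_osc f (Suc n) x + (\<integral>\<^sup>+v. p (Suc n) x v * G v \<partial>m)"
    by (simp add: distrib_left nn_integral_add local_osc_def)
  also have "(\<integral>\<^sup>+v. p (Suc n) x v * G v \<partial>m) \<le> chain_osc f (Suc n) x"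
    using Suc.IH by (auto intro!: nn_integral_mono mult_left_mono simp: G_def)
  finally show ?case by (simp add: G_def add_left_mono)
qed

end

lemma geometric_sum_le:
  fixes R w :: real
  assumes "R \<ge> 2" "w \<ge> 0"
  shows "(R - 1) * (\<Sum>j<n. w * R ^ j) \<le> w * R ^ n"
  using assms by (induction n) (auto simp: algebra_simps)

text \<open>The coefficients solve \<open>\<alpha> = \<beta> + R\<close> and \<open>\<alpha> = \<beta> * (R - 1)\<close>, which balance the terms in
  \<open>\<rho> n\<close> and in \<open>\<rho> (Suc n)\<close>.  For \<open>R = 2\<close> they are division-by-zero values, harmless as then \<open>a = 0\<close>.\<close>

lemma weight_recursion:
  fixes R w a :: real and \<rho> :: "nat \<Rightarrow> real"
  assumes "a \<ge> 0" "a = 0 \<or> R > 2" "w \<ge> 0" "\<And>j. \<rho> j \<ge> 0"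
  defines "\<alpha> \<equiv> R * (R - 1) / (R - 2)" and "\<beta> \<equiv> R / (R - 2)"
  shows "a * (w * R ^ Suc n) * (\<rho> n + \<rho> (Suc n)) +
      a * (\<alpha> * (\<Sum>j<n. w * R ^ j * (\<rho> j + \<rho> (Suc n))) + \<beta> * (w * R ^ n * (\<rho> n + \<rho> (Suc n))))
    \<le> a * (\<alpha> * (\<Sum>j<Suc n. w * R ^ j * \<rho> j) + \<beta> * (w * R ^ Suc n * \<rho> (Suc n)))"
proof (cases "a = 0")
  case False
  with assms have R: "R > 2" by simp
  have ab: "\<alpha> = \<beta> + R" "\<alpha> = \<beta> * (R - 1)" "\<beta> \<ge> 0"
    using R by (auto simp: \<alpha>_def \<beta>_def field_simps)
  define s where "s = (\<Sum>j<n. w * R ^ j)"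
  have s: "(R - 1) * s \<le> w * R ^ n"
    unfolding s_def using geometric_sum_le[of R w n] R assms by simp
  have *: "(\<Sum>j<n. w * R ^ j * (\<rho> j + \<rho> (Suc n))) = (\<Sum>j<n. w * R ^ j * \<rho> j) + s * \<rho> (Suc n)"
    by (simp add: s_def distrib_left sum.distrib sum_distrib_right)
  have "\<beta> * ((R - 1) * s) * \<rho> (Suc n) \<le> \<beta> * (w * R ^ n) * \<rho> (Suc n)"
    using s ab(3) assms(4) by (intro mult_right_mono mult_left_mono) auto
  then have **: "\<alpha> * (s * \<rho> (Suc n)) \<le> \<beta> * (w * R ^ n) * \<rho> (Suc n)"
    by (simp add: ab(2) mult_ac)
  have bR: "R + 2 * \<beta> = \<beta> * R"
    using ab by (simp add: algebra_simps)
  have "w * R ^ Suc n * (\<rho> n + \<rho> (Suc n)) +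
      (\<alpha> * (\<Sum>j<n. w * R ^ j * (\<rho> j + \<rho> (Suc n))) + \<beta> * (w * R ^ n * (\<rho> n + \<rho> (Suc n))))
     = \<alpha> * (\<Sum>j<n. w * R ^ j * \<rho> j) + (\<beta> + R) * (w * R ^ n * \<rho> n) + \<alpha> * (s * \<rho> (Suc n))
       + (R + \<beta>) * (w * R ^ n * \<rho> (Suc n))"
    unfolding * by (simp add: algebra_simps)
  also have "\<dots> \<le> \<alpha> * (\<Sum>j<n. w * R ^ j * \<rho> j) + (\<beta> + R) * (w * R ^ n * \<rho> n)
       + (R + 2 * \<beta>) * (w * R ^ n * \<rho> (Suc n))"
    using ** by (simp add: algebra_simps)
  also have "\<dots> = \<alpha> * (\<Sum>j<Suc n. w * R ^ j * \<rho> j) + \<beta> * (w * R ^ Suc n * \<rho> (Suc n))"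
    unfolding bR ab(1)[symmetric] by (simp add: algebra_simps)
  finally show ?thesis
    using mult_left_mono[of _ _ a] assms(1) by (simp only: distrib_left[symmetric] mult.assoc)
qed simp

lemma (in markov_kernels) chain_osc_le:
  fixes f :: "'a \<Rightarrow> real" and \<rho> :: "nat \<Rightarrow> 'a \<Rightarrow> real" and h :: "'a \<Rightarrow> 'a \<Rightarrow> ennreal"
    and q :: "nat \<Rightarrow> real" and a b w R :: real
  assumes [measurable]: "f \<in> borel_measurable m" "\<And>k. \<rho> k \<in> borel_measurable m"
      "case_prod h \<in> borel_measurable (m \<Otimes>\<^sub>M m)"
    and kernel_le: "\<And>k x u. p k x u \<le> ennreal (q k)" and q: "\<And>k. q k > 0"
    and osc: "\<And>k u v. p k u v \<noteq> 0 \<Longrightarrow>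
      ennreal \<bar>f u - f v\<bar> \<le>
        ennreal (\<rho> k u * (w * R ^ Suc k)) * (ennreal a + ennreal (b / q (Suc k)) * h u v)"
    and lip: "\<And>j k x u. p k x u \<noteq> 0 \<Longrightarrow> \<rho> j u \<le> \<rho> j x + \<rho> k x"
    and \<rho>: "\<And>k x. \<rho> k x \<ge> 0"
    and params: "a \<ge> 0" "b \<ge> 0" "w \<ge> 0" "R \<ge> 2" "a = 0 \<or> R > 2"
  shows "chain_osc f n x \<le>
      ennreal (a * (R * (R - 1) / (R - 2) * (\<Sum>j<n. w * R ^ j * \<rho> j x)
                    + R / (R - 2) * (w * R ^ n * \<rho> n x))) +
      ennreal b * (\<Sum>k<n. ennreal (w * R ^ Suc k) *
                    (\<integral>\<^sup>+u. ennreal (\<rho> k u) * (\<integral>\<^sup>+v. p k u v * h u v \<partial>m) \<partial>m))"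
proof (induction n arbitrary: x)
  case 0
  then show ?case by simp
next
  case (Suc n)
  define \<alpha> where "\<alpha> = R * (R - 1) / (R - 2)"
  define \<beta> where "\<beta> = R / (R - 2)"
  have ab: "\<alpha> \<ge> 0" "\<beta> \<ge> 0"
    using params by (auto simp: \<alpha>_def \<beta>_def)
  define V where "V n x = a * (\<alpha> * (\<Sum>j<n. w * R ^ j * \<rho> j x) + \<beta> * (w * R ^ n * \<rho> n x))" for n x
  define H where "H u = (\<integral>\<^sup>+v. p n u v * h u v \<partial>m)" for u
  define W where "W n = (\<Sum>k<n. ennreal (w * R ^ Suc k) *
                    (\<integral>\<^sup>+u. ennreal (\<rho> k u) * (\<integral>\<^sup>+v. p k u v * h u v \<partial>m) \<partial>m))" for n
  define y where "y = w * R ^ Suc n"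
  have y: "y \<ge> 0" using params by (simp add: y_def)
  have V_nonneg: "V n x \<ge> 0" for n x
    unfolding V_def using params ab \<rho>
    by (intro mult_nonneg_nonneg add_nonneg_nonneg sum_nonneg) auto
  have [measurable]: "H \<in> borel_measurable m"
    unfolding H_def by measurable
  have IH: "chain_osc f n u \<le> ennreal (V n u) + ennreal b * W n" for u
    using Suc.IH[of u] by (simp add: V_def \<alpha>_def \<beta>_def W_def)
  have loc: "local_osc f n u \<le>
      ennreal (a * y * \<rho> n u) + ennreal (y * b / q (Suc n)) * (ennreal (\<rho> n u) * H u)" for u
  proof -
    have "local_osc f n u \<le>
        (\<integral>\<^sup>+v. p n u v * ennreal (a * y * \<rho> n u)
               + ennreal (y * b / q (Suc n)) * (ennreal (\<rho> n u) * (p n u v * h u v)) \<partial>m)"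
      unfolding local_osc_def
    proof (intro nn_integral_mono)
      fix v
      show "p n u v * ennreal \<bar>f u - f v\<bar> \<le> p n u v * ennreal (a * y * \<rho> n u)
               + ennreal (y * b / q (Suc n)) * (ennreal (\<rho> n u) * (p n u v * h u v))"
      proof (cases "p n u v = 0")
        case False
        have "ennreal \<bar>f u - f v\<bar> \<le>
            ennreal (\<rho> n u * y) * (ennreal a + ennreal (b / q (Suc n)) * h u v)"
          using osc[OF False] by (simp add: y_def)
        also have "\<dots> = ennreal (a * y * \<rho> n u)
            + ennreal (y * b / q (Suc n)) * (ennreal (\<rho> n u) * h u v)"
          using y \<rho>[of n u] params q[of "Suc n"]
          by (simp add: distrib_left flip: mult.assoc ennreal_mult'') (simp add: mult_ac)
        finally have "p n u v * ennreal \<bar>f u - f v\<bar> \<le> p n u v * (ennreal (a * y * \<rho> n u)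
            + ennreal (y * b / q (Suc n)) * (ennreal (\<rho> n u) * h u v))"
          by (rule mult_left_mono) simp
        then show ?thesis by (simp add: distrib_left mult_ac)
      qed simp
    qed
    also have "\<dots> = ennreal (a * y * \<rho> n u)
        + ennreal (y * b / q (Suc n)) * (ennreal (\<rho> n u) * H u)"
      by (simp add: nn_integral_add nn_integral_cmult kernel_integral_const H_def)
    finally show ?thesis .
  qed
  have pt: "p (Suc n) x u * (local_osc f n u + chain_osc f n u) \<le>
      p (Suc n) x u * (ennreal (V (Suc n) x) + ennreal b * W n) +
      ennreal (b * y) * (ennreal (\<rho> n u) * H u)" for u
  proof (cases "p (Suc n) x u = 0")
    case False
    have l: "\<rho> j u \<le> \<rho> j x + \<rho> (Suc n) x" for j
      using lip[OF False] .
    have "a * y * \<rho> n u + V n u \<le> a * y * (\<rho> n x + \<rho> (Suc n) x) +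
      a * (\<alpha> * (\<Sum>j<n. w * R ^ j * (\<rho> j x + \<rho> (Suc n) x))
        + \<beta> * (w * R ^ n * (\<rho> n x + \<rho> (Suc n) x)))"
      unfolding V_def using params ab y
      by (intro add_mono mult_left_mono sum_mono l) auto
    also have "\<dots> \<le> V (Suc n) x"
      unfolding V_def y_def \<alpha>_def \<beta>_def
      using weight_recursion[of a R w "\<lambda>j. \<rho> j x" n] params \<rho> by simp
    finally have V: "ennreal (a * y * \<rho> n u) + ennreal (V n u) \<le> ennreal (V (Suc n) x)"
      using V_nonneg[of n u] params y \<rho>[of n u] by (simp flip: ennreal_plus add: ennreal_leI)
    have "p (Suc n) x u * (ennreal (y * b / q (Suc n)) * (ennreal (\<rho> n u) * H u)) \<le>
        ennreal (q (Suc n)) * (ennreal (y * b / q (Suc n)) * (ennreal (\<rho> n u) * H u))"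
      by (intro mult_right_mono kernel_le) auto
    also have "\<dots> = ennreal (b * y) * (ennreal (\<rho> n u) * H u)"
      using q[of "Suc n"] params y
      by (simp flip: mult.assoc ennreal_mult'') (simp add: mult_ac)
    finally have Hle: "p (Suc n) x u * (ennreal (y * b / q (Suc n)) * (ennreal (\<rho> n u) * H u)) \<le>
        ennreal (b * y) * (ennreal (\<rho> n u) * H u)" .
    have "p (Suc n) x u * (local_osc f n u + chain_osc f n u) \<le>
        p (Suc n) x u * ((ennreal (a * y * \<rho> n u)
          + ennreal (y * b / q (Suc n)) * (ennreal (\<rho> n u) * H u))
          + (ennreal (V n u) + ennreal b * W n))"
      by (intro mult_left_mono add_mono loc IH) auto
    also have "\<dots> = p (Suc n) x u * ((ennreal (a * y * \<rho> n u) + ennreal (V n u)) + ennreal b * W n)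
        + p (Suc n) x u * (ennreal (y * b / q (Suc n)) * (ennreal (\<rho> n u) * H u))"
      by (simp add: distrib_left add_ac)
    also have "\<dots> \<le> p (Suc n) x u * (ennreal (V (Suc n) x) + ennreal b * W n)
        + ennreal (b * y) * (ennreal (\<rho> n u) * H u)"
      by (intro add_mono mult_left_mono V Hle) auto
    finally show ?thesis .
  qed simp
  have "chain_osc f (Suc n) x \<le> (\<integral>\<^sup>+u. p (Suc n) x u * (ennreal (V (Suc n) x) + ennreal b * W n) +
      ennreal (b * y) * (ennreal (\<rho> n u) * H u) \<partial>m)"
    by (simp only: chain_osc.simps) (intro nn_integral_mono pt)
  also have "\<dots> = ennreal (V (Suc n) x) + ennreal b * W n +
      ennreal (b * y) * (\<integral>\<^sup>+u. ennreal (\<rho> n u) * H u \<partial>m)"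
    by (simp add: nn_integral_add nn_integral_cmult kernel_integral_const)
  also have "\<dots> = ennreal (V (Suc n) x) + ennreal b * W (Suc n)"
    using params y
    by (simp only: W_def H_def sum.lessThan_Suc distrib_left ennreal_mult mult.assoc add.assoc
        flip: y_def)
  finally show ?case
    by (simp only: V_def W_def \<alpha>_def \<beta>_def)
qed


lemma truncated_geometric_sum_le:
  fixes R w z :: real
  assumes "R \<ge> 2" "w \<ge> 0" "z \<ge> 0"
  shows "(1 - 1 / R) * (\<Sum>j<n. w * R ^ j * of_bool (w * R ^ j \<le> z)) \<le> z"
proof (induction n)
  case (Suc n)
  show ?case
  proof (cases "w * R ^ n \<le> z")
    case True
    have "(1 - 1 / R) * (\<Sum>j<Suc n. w * R ^ j * of_bool (w * R ^ j \<le> z))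
        \<le> (1 - 1 / R) * (\<Sum>j<Suc n. w * R ^ j)"
      using assms by (intro mult_left_mono sum_mono) (auto simp: of_bool_def)
    also have "\<dots> \<le> w * R ^ n"
      using geometric_sum_le[of R w "Suc n"] assms by (simp add: field_simps)
    finally show ?thesis using True by simp
  qed (use Suc in simp)
qed (use assms in simp)

section \<open>Metric spaces with a measure of full support\<close>

locale full_support_prob = prob_space m for m :: "'a::metric_space measure" +
  assumes sets_eq_borel [measurable_cong, simp]: "sets m = sets borel"
    and open_pos: "\<And>U. open U \<Longrightarrow> U \<noteq> {} \<Longrightarrow> emeasure m U > 0"
begin

lemma space_UNIV [simp]: "space m = UNIV"
  using sets_eq_imp_space_eq[OF sets_eq_borel] by simp

lemma measure_cball_pos: "\<epsilon> > 0 \<Longrightarrow> measure m (cball x \<epsilon>) > 0"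
  using open_pos[of "ball x \<epsilon>"] emeasure_mono[of "ball x \<epsilon>" "cball x \<epsilon>" m]
  by (simp add: emeasure_eq_measure)

lemma closed_full_measure:
  assumes "closed C" "measure m C = 1"
  shows "C = UNIV"
proof (rule ccontr)
  assume "C \<noteq> UNIV"
  then have "emeasure m (- C) > 0"
    using assms by (intro open_pos) auto
  moreover have "measure m (- C) = 0"
    using prob_compl[of C] assms by (simp add: Compl_eq_Diff_UNIV)
  ultimately show False by (simp add: emeasure_eq_measure)
qed

text \<open>A set whose balls of radius \<open>\<delta> / 2\<close> exhaust as much measure as those of any countable set
  can is \<open>\<delta>\<close>-dense, since any further ball would add mass.\<close>

lemma countable_net:
  assumes "\<delta> > 0"
  shows "\<exists>S :: 'a set. countable S \<and> S \<noteq> {} \<and> (\<forall>x. \<exists>s\<in>S. dist s x < \<delta>)"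
proof -
  define g where "g S = emeasure m (\<Union>s\<in>S. ball s (\<delta> / 2))" for S
  let ?C = "{S :: 'a set. countable S}"
  have "?C \<noteq> {}" by auto
  then obtain h :: "nat \<Rightarrow> ennreal" where h: "range h \<subseteq> g ` ?C" "Sup (g ` ?C) = (SUP i. h i)"
    using ennreal_SUP_countable_SUP[of ?C g] by blast
  then have "\<exists>S. countable S \<and> h i = g S" for i
    using rangeI[of h i] by blast
  then obtain T where T: "\<And>i. countable (T i)" "\<And>i. h i = g (T i)" by metis
  define S where "S = (\<Union>i. T i)"
  have S: "countable S" using T by (simp add: S_def)
  have le: "g S' \<le> g S" if "countable S'" for S'
  proof -
    have "g S' \<le> (SUP i. h i)"
      unfolding h(2)[symmetric] using that by (intro SUP_upper) auto
    also have "\<dots> \<le> g S"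
    proof (rule SUP_least)
      show "h i \<le> g S" for i
        unfolding T(2) g_def
      proof (rule emeasure_mono[OF UN_mono])
        show "T i \<subseteq> S" by (auto simp: S_def)
        show "(\<Union>s\<in>S. ball s (\<delta> / 2)) \<in> sets m" by (auto intro!: borel_open open_UN)
      qed simp
    qed
    finally show ?thesis .
  qed
  have dense: "\<exists>s\<in>S. dist s x < \<delta>" for x
  proof (rule ccontr)
    assume *: "\<not> (\<exists>s\<in>S. dist s x < \<delta>)"
    have "ball x (\<delta> / 2) \<inter> (\<Union>s\<in>S. ball s (\<delta> / 2)) = {}"
    proof (rule ccontr)
      assume "ball x (\<delta> / 2) \<inter> (\<Union>s\<in>S. ball s (\<delta> / 2)) \<noteq> {}"
      then obtain s z where "s \<in> S" "dist x z < \<delta> / 2" "dist s z < \<delta> / 2" by auto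
      then have "dist s x < \<delta>"
        using dist_triangle2[of s x z] by simp
      with * \<open>s \<in> S\<close> show False by auto
    qed
    then have "g (insert x S) = emeasure m (ball x (\<delta> / 2)) + g S"
      unfolding g_def UN_insert by (intro plus_emeasure[symmetric]) (auto intro!: borel_open)
    moreover have "g (insert x S) \<le> g S" using S by (intro le) simp
    moreover have "emeasure m (ball x (\<delta> / 2)) > 0" using assms by (intro open_pos) auto
    moreover have "g S \<noteq> \<infinity>" by (simp add: g_def)
    ultimately show False
      using ennreal_add_left_cancel_le[of "g S" _ 0] by (simp add: add.commute)
  qed
  then have "S \<noteq> {}" by blast
  show ?thesis
    by (intro exI[of _ S] conjI allI) fact+
qed

lemma dense_sequence:
  obtains e :: "nat \<Rightarrow> 'a" where "\<And>x \<delta>. \<delta> > 0 \<Longrightarrow> \<exists>i. dist (e i) x < \<delta>"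
proof -
  have "\<exists>S. \<forall>n::nat. countable (S n) \<and> S n \<noteq> {} \<and> (\<forall>x::'a. \<exists>s\<in>S n. dist s x < 1 / Suc n)"
    by (intro choice allI countable_net) simp
  then obtain S where S: "\<forall>n::nat. countable (S n) \<and> S n \<noteq> {} \<and> (\<forall>x::'a. \<exists>s\<in>S n. dist s x < 1 / Suc n)"
    ..
  define e where "e = from_nat_into (\<Union>n. S n)"
  have "countable (S n)" "S n \<noteq> {}" for n
    using spec[OF S, of n] by simp_all
  then have range: "range e = (\<Union>n. S n)"
    unfolding e_def by (intro range_from_nat_into) auto
  have S3: "\<exists>s\<in>S n. dist s x < 1 / Suc n" for n x using S by blast
  show thesis
  proof (rule that)
    fix x :: 'a and \<delta> :: real assume "\<delta> > 0"
    then obtain n :: nat where n: "1 / Suc n < \<delta>" by (rule nat_approx_posE)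
    obtain s where s: "s \<in> S n" "dist s x < 1 / Suc n" using S3[of n x] ..
    have "s \<in> range e" unfolding range using s(1) by blast
    then obtain i where i: "s = e i" ..
    have "dist (e i) x < \<delta>" using n s i by simp
    then show "\<exists>i. dist (e i) x < \<delta>" ..
  qed
qed
lemma discretization:
  assumes "\<delta> > 0"
  obtains e :: "nat \<Rightarrow> 'a" and N where "N \<in> measurable m (count_space UNIV)" "\<And>x. dist (e (N x)) x < \<delta>"
proof -
  obtain e :: "nat \<Rightarrow> 'a" where e: "\<And>x \<delta>. \<delta> > 0 \<Longrightarrow> \<exists>i. dist (e i) x < \<delta>"
    using dense_sequence by blast
  have [measurable]: "(\<lambda>x. dist (e i) x) \<in> borel_measurable m" for i
    by (simp add: measurable_cong_sets[OF sets_eq_borel refl])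
       (intro borel_measurable_continuous_onI continuous_intros)
  show thesis
  proof (rule that)
    show "(\<lambda>x. LEAST i. dist (e i) x < \<delta>) \<in> measurable m (count_space UNIV)"
      by measurable
    show "dist (e (LEAST i. dist (e i) x < \<delta>)) x < \<delta>" for x
      using LeastI_ex[OF e[OF assms, of x]] .
  qed
qed

lemma dist_measurable [measurable]: "(\<lambda>(x, u). dist x u) \<in> borel_measurable (m \<Otimes>\<^sub>M m)"
proof -
  obtain e :: "nat \<Rightarrow> 'a" where e: "\<And>x \<delta>. \<delta> > 0 \<Longrightarrow> \<exists>i. dist (e i) x < \<delta>"
    using dense_sequence by blast
  define d where "d i x = dist (e i) x" for i x
  have [measurable]: "d i \<in> borel_measurable m" for i
    unfolding d_def measurable_cong_sets[OF sets_eq_borel refl]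
    by (intro borel_measurable_continuous_onI continuous_intros)
  have lt: "dist x u < c \<longleftrightarrow> (\<exists>i. dist (e i) x + dist (e i) u < c)" for x u c
  proof
    assume "dist x u < c"
    then obtain i where "dist (e i) x < (c - dist x u) / 2"
      using e[of "(c - dist x u) / 2" x] by auto
    moreover have "dist (e i) u \<le> dist (e i) x + dist x u" by metric
    ultimately show "\<exists>i. dist (e i) x + dist (e i) u < c"
      by (intro exI[of _ i]) argo
  next
    assume "\<exists>i. dist (e i) x + dist (e i) u < c"
    then obtain i where "dist (e i) x + dist (e i) u < c" ..
    then show "dist x u < c" by metric
  qed
  show ?thesis
    unfolding borel_measurable_iff_less case_prod_beta lt d_def[symmetric]
    by (intro allI) measurable
qed

end

section \<open>Balls of prescribed measure\<close>

lemma class_G_phi_inv: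
  assumes "\<phi> \<in> class_G a b" "t \<ge> 0"
  shows "phi_inv \<phi> t \<ge> 0" "\<phi> (phi_inv \<phi> t) = t"
proof -
  have "t \<in> \<phi> ` {0..}"
    using assms by (simp add: class_G_def)
  then show "phi_inv \<phi> t \<ge> 0" "\<phi> (phi_inv \<phi> t) = t"
    unfolding phi_inv_def using inv_into_into[of t \<phi> "{0..}"] f_inv_into_f[of t \<phi> "{0..}"] by auto
qed

lemma class_G_le_iff:
  assumes "\<phi> \<in> class_G a b" "x \<ge> 0" "y \<ge> 0"
  shows "\<phi> x \<le> \<phi> y \<longleftrightarrow> x \<le> y"
  using assms strict_mono_on_leD[of "{0..}" \<phi>] strict_mono_onD[of "{0..}" \<phi> y x]
  by (fastforce simp: class_G_def not_le[symmetric] dest: leD)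

lemma class_G_nonneg:
  assumes "\<phi> \<in> class_G a b" "x \<ge> 0"
  shows "\<phi> x \<ge> 0"
  using class_G_le_iff[OF assms(1), of 0 x] assms by (simp add: class_G_def)

lemma class_G_phi_inv_le_iff:
  assumes "\<phi> \<in> class_G a b" "t \<ge> 0" "z \<ge> 0"
  shows "z \<le> phi_inv \<phi> t \<longleftrightarrow> \<phi> z \<le> t"
  using class_G_le_iff[OF assms(1,3) class_G_phi_inv(1)[OF assms(1,2)]] class_G_phi_inv[OF assms(1,2)]
  by simp

lemma (in full_support_prob) dist_le_sigma:
  fixes s t x :: 'a
  assumes "\<phi> \<in> class_G a b"
  shows "ennreal (phi_inv \<phi> 1) * ennreal (dist s t) \<le> mm_sigma \<phi> m x"
proof -
  have "ennreal (phi_inv \<phi> 1) * ennreal (dist s t) =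
      (\<integral>\<^sup>+\<epsilon>. ennreal (phi_inv \<phi> 1) * indicator {0<..<dist s t} \<epsilon> \<partial>lborel)"
    by (simp add: nn_integral_cmult)
  also have "\<dots> \<le> mm_sigma \<phi> m x"
    unfolding mm_sigma_def
  proof (intro nn_integral_mono)
    fix \<epsilon> :: real
    show "ennreal (phi_inv \<phi> 1) * indicator {0<..<dist s t} \<epsilon>
        \<le> ennreal (phi_inv \<phi> (1 / measure m (cball x \<epsilon>))) *
          indicator {\<epsilon>. 0 < \<epsilon> \<and> ennreal \<epsilon> < ediameter (UNIV :: 'a set)} \<epsilon>"
    proof (cases "\<epsilon> \<in> {0<..<dist s t}")
      case True
      then have "ennreal \<epsilon> < ennreal (dist s t)" by (simp add: ennreal_less_iff)
      also have "\<dots> \<le> ediameter (UNIV :: 'a set)"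
        unfolding ediameter_def by (intro SUP_upper2[of s] SUP_upper2[of t]) auto
      finally have "ennreal \<epsilon> < ediameter (UNIV :: 'a set)" .
      moreover have "measure m (cball x \<epsilon>) > 0" using True by (intro measure_cball_pos) simp
      then have "phi_inv \<phi> 1 \<le> phi_inv \<phi> (1 / measure m (cball x \<epsilon>))"
        using class_G_phi_inv[OF assms, of 1] prob_le_1[of "cball x \<epsilon>"]
          class_G_phi_inv_le_iff[OF assms, of "1 / measure m (cball x \<epsilon>)" "phi_inv \<phi> 1"]
        by (simp add: field_simps)
      ultimately show ?thesis using True by (simp add: ennreal_leI)
    qed simp
  qed
  finally show ?thesis .
qed

locale majorizing_setup = full_support_prob m for m :: "'a::metric_space measure" +
  fixes \<phi> :: "real \<Rightarrow> real" and a b R D :: real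
  assumes class_G: "\<phi> \<in> class_G a b"
    and params: "a \<ge> 0" "b \<ge> 0" "R \<ge> 2" "D \<ge> 0"
    and ediameter_eq: "ediameter (UNIV :: 'a set) = ennreal D"
begin

definition scale :: "nat \<Rightarrow> real" where
  "scale k = phi_inv \<phi> 1 * R ^ k"

definition level :: "nat \<Rightarrow> real" where
  "level k = \<phi> (scale k)"

definition rad :: "nat \<Rightarrow> 'a \<Rightarrow> real" where
  "rad k x = Inf {\<epsilon>. 0 \<le> \<epsilon> \<and> 1 / level k \<le> measure m (cball x \<epsilon>)}"

definition ball_kernel :: "nat \<Rightarrow> 'a \<Rightarrow> 'a \<Rightarrow> ennreal" where
  "ball_kernel k x u = indicator (cball x (rad k x)) u / emeasure m (cball x (rad k x))"

lemma phi_0: "\<phi> 0 = 0"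
  using class_G by (simp add: class_G_def)

lemma phi_inv_1_pos: "phi_inv \<phi> 1 > 0"
  using class_G_phi_inv[OF class_G, of 1] phi_0 by (cases "phi_inv \<phi> 1 = 0") auto

lemma scale_pos: "scale k > 0"
  using phi_inv_1_pos params by (simp add: scale_def)

lemma scale_ge: "scale k \<ge> phi_inv \<phi> 1"
  using phi_inv_1_pos params one_le_power[of R k]
  by (simp add: scale_def mult_le_cancel_left1)

lemma level_0: "level 0 = 1"
  using class_G_phi_inv[OF class_G, of 1] by (simp add: level_def scale_def)

lemma level_ge_1: "level k \<ge> 1"
  using class_G_phi_inv_le_iff[OF class_G, of "level k" "phi_inv \<phi> 1"]
    class_G_phi_inv[OF class_G, of 1] scale_ge[of k] scale_pos[of k]
    class_G_le_iff[OF class_G, of "phi_inv \<phi> 1" "scale k"]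
  by (simp add: level_def)

lemma level_at_top: "\<forall>c. \<exists>N. \<forall>n\<ge>N. level n \<ge> c"
proof
  fix c :: real
  define c' where "c' = max c 0"
  obtain N where N: "phi_inv \<phi> c' / phi_inv \<phi> 1 < R ^ N"
    using real_arch_pow[of R] params by auto
  have "level n \<ge> c" if "n \<ge> N" for n
  proof -
    have "phi_inv \<phi> c' \<le> phi_inv \<phi> 1 * R ^ N"
      using N phi_inv_1_pos by (simp add: field_simps)
    also have "\<dots> \<le> scale n"
      unfolding scale_def using that params phi_inv_1_pos by (intro mult_left_mono power_increasing) auto
    finally have "\<phi> (phi_inv \<phi> c') \<le> level n"
      unfolding level_def
      using class_G_le_iff[OF class_G, of "phi_inv \<phi> c'" "scale n"] scale_pos[of n]
        class_G_phi_inv[OF class_G, of c']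
      by (simp add: c'_def)
    then show ?thesis
      using class_G_phi_inv[OF class_G, of c'] by (simp add: c'_def)
  qed
  then show "\<exists>N. \<forall>n\<ge>N. level n \<ge> c" by blast
qed

lemma dist_le_D: "dist (s::'a) t \<le> D"
proof -
  have "ennreal (dist s t) \<le> ediameter (UNIV :: 'a set)"
    unfolding ediameter_def by (intro SUP_upper2[of s] SUP_upper2[of t]) auto
  then show ?thesis
    using params by (simp add: ediameter_eq)
qed

lemma cball_in_sets [simp, measurable]: "cball x \<epsilon> \<in> sets m"
  by (auto intro!: borel_closed)

lemma D_admissible: "1 / level k \<le> measure m (cball x D)"
proof -
  have "cball x D = space m" using dist_le_D by auto
  then show ?thesis using prob_space level_ge_1[of k] by simp
qed

lemma rad_le:
  assumes "0 \<le> \<epsilon>" "1 / level k \<le> measure m (cball x \<epsilon>)"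
  shows "rad k x \<le> \<epsilon>"
  unfolding rad_def using assms by (intro cInf_lower bdd_belowI[of _ 0]) auto

lemma rad_le_D: "rad k x \<le> D"
  by (intro rad_le D_admissible params)

lemma rad_nonneg: "0 \<le> rad k x"
  unfolding rad_def using D_admissible params by (intro cInf_greatest) auto

lemma measure_cball_less:
  assumes "0 \<le> \<epsilon>" "\<epsilon> < rad k x"
  shows "measure m (cball x \<epsilon>) < 1 / level k"
  using rad_le[of \<epsilon> k x] assms by (meson not_le)

lemma measure_cball_rad: "1 / level k \<le> measure m (cball x (rad k x))"
proof -
  have adm: "1 / level k \<le> measure m (cball x \<epsilon>)" if "\<epsilon> > rad k x" for \<epsilon>
  proof -
    have inf: "Inf {\<epsilon>. 0 \<le> \<epsilon> \<and> 1 / level k \<le> measure m (cball x \<epsilon>)} < \<epsilon>"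
      using that by (simp add: rad_def)
    have "{\<epsilon>. 0 \<le> \<epsilon> \<and> 1 / level k \<le> measure m (cball x \<epsilon>)} \<noteq> {}"
      using D_admissible params by blast
    from cInf_lessD[OF this inf] obtain \<epsilon>' where "1 / level k \<le> measure m (cball x \<epsilon>')" "\<epsilon>' < \<epsilon>"
      by auto
    moreover have "measure m (cball x \<epsilon>') \<le> measure m (cball x \<epsilon>)"
      using \<open>\<epsilon>' < \<epsilon>\<close> by (intro finite_measure_mono) auto
    ultimately show ?thesis by simp
  qed
  define E where "E n = rad k x + inverse (real (Suc n))" for n
  have "E \<longlonglongrightarrow> rad k x + 0"
    unfolding E_def by (intro tendsto_add tendsto_const LIMSEQ_inverse_real_of_nat)
  then have E: "E \<longlonglongrightarrow> rad k x" by simp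
  have dec: "decseq E"
    unfolding E_def decseq_def by (auto intro!: le_imp_inverse_le)
  have "(\<lambda>n. measure m (cball x (E n))) \<longlonglongrightarrow> measure m (\<Inter>n. cball x (E n))"
    using dec by (intro finite_Lim_measure_decseq) (auto simp: decseq_def, meson order_trans)
  also have "(\<Inter>n. cball x (E n)) = cball x (rad k x)"
  proof (intro subset_antisym subsetI)
    fix u assume "u \<in> (\<Inter>n. cball x (E n))"
    then have "\<And>n. dist x u \<le> E n" by simp
    then have "dist x u \<le> rad k x"
      by (intro LIMSEQ_le_const[OF E]) auto
    then show "u \<in> cball x (rad k x)" by simp
  qed (auto simp: E_def intro: order_trans)
  finally show ?thesis
    by (rule LIMSEQ_le_const) (auto simp: E_def intro!: adm)
qed

lemma rad_lipschitz: "rad k u \<le> rad k x + dist x u"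
proof (rule rad_le)
  have "cball x (rad k x) \<subseteq> cball u (rad k x + dist x u)"
  proof
    fix z assume "z \<in> cball x (rad k x)"
    then show "z \<in> cball u (rad k x + dist x u)"
      using dist_triangle3[of u z x] by simp
  qed
  then show "1 / level k \<le> measure m (cball u (rad k x + dist x u))"
    using measure_cball_rad[of k x] finite_measure_mono[of "cball x (rad k x)"]
    by (meson cball_in_sets order_trans)
qed (simp add: rad_nonneg)

lemma rad_measurable [measurable]: "rad k \<in> borel_measurable m"
proof -
  have "continuous_on UNIV (rad k)"
  proof (rule continuous_onI)
    fix x :: 'a and e :: real assume "e > 0"
    have "dist (rad k u) (rad k x) \<le> e" if "dist u x < e" for u
      using rad_lipschitz[of k u x] rad_lipschitz[of k x u] that
      by (auto simp: dist_real_def dist_commute)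
    with \<open>e > 0\<close> show "\<exists>d>0. \<forall>x'\<in>UNIV. dist x' x < d \<longrightarrow> dist (rad k x') (rad k x) \<le> e"
      by blast
  qed
  then show ?thesis
    unfolding measurable_cong_sets[OF sets_eq_borel refl] by (rule borel_measurable_continuous_onI)
qed

lemma rad_tendsto_0: "(\<lambda>k. rad k x) \<longlonglongrightarrow> 0"
proof (rule LIMSEQ_I)
  fix e :: real assume "e > 0"
  then have pos: "measure m (cball x (e / 2)) > 0" by (intro measure_cball_pos) simp
  obtain N where N: "\<And>n. n \<ge> N \<Longrightarrow> level n \<ge> 1 / measure m (cball x (e / 2))"
    using level_at_top by blast
  have "norm (rad n x - 0) < e" if "n \<ge> N" for n
  proof -
    have "rad n x \<le> e / 2"
      using N[OF that] pos level_ge_1[of n] \<open>e > 0\<close> by (intro rad_le) (auto simp: field_simps)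
    then show ?thesis using rad_nonneg[of n x] \<open>e > 0\<close> by simp
  qed
  then show "\<exists>N. \<forall>n\<ge>N. norm (rad n x - 0) < e" by blast
qed

lemma ball_kernel_nonzeroD: "ball_kernel k x u \<noteq> 0 \<Longrightarrow> dist x u \<le> rad k x"
  by (auto simp: ball_kernel_def indicator_def split: if_splits)

lemma ball_kernel_le: "ball_kernel k x u \<le> ennreal (level k)"
proof -
  have q: "level k > 0" using level_ge_1[of k] by simp
  have "ball_kernel k x u \<le> 1 / emeasure m (cball x (rad k x))"
    unfolding ball_kernel_def by (intro divide_right_mono_ennreal) (simp add: indicator_def)
  also have "\<dots> \<le> ennreal (level k)"
  proof -
    have pos: "measure m (cball x (rad k x)) > 0"
      using measure_cball_rad[of k x] q by (meson divide_pos_pos less_le_trans zero_less_one)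
    have "1 / measure m (cball x (rad k x)) \<le> level k"
      using measure_cball_rad[of k x] q pos by (simp add: field_simps)
    then show ?thesis
      using pos divide_ennreal[of 1 "measure m (cball x (rad k x))"]
      by (simp add: emeasure_eq_measure ennreal_leI)
  qed
  finally show ?thesis .
qed

sublocale markov_kernels m ball_kernel
proof
  fix k x u
  have [measurable]: "Measurable.pred (m \<Otimes>\<^sub>M m) (\<lambda>z. dist (fst z) (snd z) \<le> rad k (fst z))"
    using dist_measurable by (simp add: case_prod_beta)
  have eq: "emeasure m (cball x (rad k x)) = (\<integral>\<^sup>+u. indicator {z. dist (fst z) (snd z) \<le> rad k (fst z)} (x, u) \<partial>m)" for x
  proof -
    have "(\<lambda>u. indicator {z. dist (fst z) (snd z) \<le> rad k (fst z)} (x, u) :: ennreal) =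
        indicator (cball x (rad k x))"
      by (auto simp: indicator_def fun_eq_iff)
    then show ?thesis by simp
  qed
  have "case_prod (ball_kernel k) =
      (\<lambda>z. indicator {z. dist (fst z) (snd z) \<le> rad k (fst z)} z /
        (\<integral>\<^sup>+u. indicator {z. dist (fst z) (snd z) \<le> rad k (fst z)} (fst z, u) \<partial>m))"
    unfolding eq[symmetric] by (auto simp: fun_eq_iff ball_kernel_def indicator_def)
  also have "\<dots> \<in> borel_measurable (m \<Otimes>\<^sub>M m)"
    by measurable
  finally show "case_prod (ball_kernel k) \<in> borel_measurable (m \<Otimes>\<^sub>M m)" .
  show "space m = UNIV" by simp
  have pos: "measure m (cball x (rad k x)) > 0" for x k
    using measure_cball_rad[of k x] level_ge_1[of k]
    by (smt (verit) divide_pos_pos)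
  show "(\<integral>\<^sup>+u. ball_kernel k x u \<partial>m) = 1"
    unfolding ball_kernel_def
    using pos[of x k] by (simp add: nn_integral_divide ennreal_divide_self emeasure_eq_measure)
  have "measure m (cball x (rad 0 x)) = 1"
    using measure_cball_rad[of 0 x] level_0 prob_le_1[of "cball x (rad 0 x)"] by simp
  then have "cball x (rad 0 x) = UNIV" "emeasure m (cball x (rad 0 x)) = 1"
    using closed_full_measure[OF closed_cball, of x "rad 0 x"] by (simp_all add: emeasure_eq_measure)
  then show "ball_kernel 0 x u = 1"
    by (simp add: ball_kernel_def)
qed

lemma sum_rad_le_sigma:
  "ennreal (1 - 1 / R) * (\<Sum>j<n. ennreal (scale j) * ennreal (rad j x)) \<le> mm_sigma \<phi> m x"
proof -
  have R: "1 - 1 / R \<ge> 0" using params by (simp add: field_simps)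
  have "ennreal (1 - 1 / R) * (\<Sum>j<n. ennreal (scale j) * ennreal (rad j x)) =
      (\<integral>\<^sup>+\<epsilon>. ennreal (1 - 1 / R) * (\<Sum>j<n. ennreal (scale j) * indicator {0<..<rad j x} \<epsilon>) \<partial>lborel)"
  proof -
    have "(\<integral>\<^sup>+\<epsilon>. ennreal (scale j) * indicator {0<..<rad j x} \<epsilon> \<partial>lborel) =
        ennreal (scale j) * ennreal (rad j x)" for j
      by (simp add: nn_integral_cmult rad_nonneg)
    then show ?thesis
      by (subst nn_integral_cmult, measurable) (subst nn_integral_sum, auto)
  qed
  also have "\<dots> \<le> mm_sigma \<phi> m x"
    unfolding mm_sigma_def
  proof (intro nn_integral_mono)
    fix \<epsilon> :: real
    let ?l = "ennreal (1 - 1 / R) * (\<Sum>j<n. ennreal (scale j) * indicator {0<..<rad j x} \<epsilon>)"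
    show "?l \<le> ennreal (phi_inv \<phi> (1 / measure m (cball x \<epsilon>))) *
        indicator {\<epsilon>. 0 < \<epsilon> \<and> ennreal \<epsilon> < ediameter (UNIV :: 'a set)} \<epsilon>"
    proof (cases "0 < \<epsilon> \<and> \<epsilon> < D")
      case True
      define z where "z = phi_inv \<phi> (1 / measure m (cball x \<epsilon>))"
      have pos: "measure m (cball x \<epsilon>) > 0" using True by (intro measure_cball_pos) simp
      have z: "z \<ge> 0" unfolding z_def by (intro class_G_phi_inv[OF class_G]) simp
      have le: "scale j \<le> z" if "\<epsilon> < rad j x" for j
      proof -
        have "measure m (cball x \<epsilon>) < 1 / level j"
          using True that by (intro measure_cball_less) auto
        then have "level j \<le> 1 / measure m (cball x \<epsilon>)"
          using pos level_ge_1[of j] by (simp add: field_simps)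
        then show ?thesis
          unfolding z_def level_def
          using class_G_phi_inv_le_iff[OF class_G, of "1 / measure m (cball x \<epsilon>)" "scale j"]
            scale_pos[of j] by simp
      qed
      have "?l \<le> ennreal (1 - 1 / R) * (\<Sum>j<n. ennreal (scale j * of_bool (scale j \<le> z)))"
        using le by (intro mult_left_mono sum_mono) (auto simp: indicator_def)
      also have "\<dots> = ennreal ((1 - 1 / R) * (\<Sum>j<n. scale j * of_bool (scale j \<le> z)))"
        using R scale_pos by (subst sum_ennreal) (auto simp: less_imp_le ennreal_mult' sum_nonneg)
      also have "\<dots> \<le> ennreal z"
        unfolding scale_def using params phi_inv_1_pos z
        by (intro ennreal_leI truncated_geometric_sum_le) auto
      finally show ?thesis using True by (simp add: z_def ediameter_eq ennreal_less_iff)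
    next
      case False
      then have "\<epsilon> \<notin> {0<..<rad j x}" for j
        using rad_le_D[of j x] by auto
      then show ?thesis by simp
    qed
  qed
  finally show ?thesis .
qed

end

section \<open>Processes with bounded increments\<close>

locale bounded_increments = majorizing_setup m \<phi> a b R D
  for m :: "'a::metric_space measure" and \<phi> a b R D +
  fixes M :: "'w measure" and X :: "'a \<Rightarrow> 'w \<Rightarrow> real"
  assumes prob_M: "prob_space M"
    and X_measurable [measurable]: "\<And>t. X t \<in> borel_measurable M"
    and increment_le_1: "\<And>s t. (\<integral>\<^sup>+\<omega>. ennreal (\<phi> (\<bar>X s \<omega> - X t \<omega>\<bar> / dist s t)) \<partial>M) \<le> 1"
begin

lemma phi_comp_measurable:
  assumes [measurable]: "g \<in> borel_measurable N" and "\<And>x. g x \<ge> 0"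
  shows "(\<lambda>x. \<phi> (g x)) \<in> borel_measurable N"
proof -
  have "continuous_on UNIV (\<lambda>x. \<phi> (max 0 x))"
  proof (rule continuous_on_compose2[of "{0..}" \<phi>])
    show "continuous_on {0..} \<phi>" using class_G by (simp add: class_G_def)
    show "continuous_on UNIV (\<lambda>x::real. max 0 x)" by (intro continuous_intros)
  qed auto
  then have [measurable]: "(\<lambda>x. \<phi> (max 0 x)) \<in> borel_measurable borel"
    by (rule borel_measurable_continuous_onI)
  have "(\<lambda>x. \<phi> (max 0 (g x))) \<in> borel_measurable N" by measurable
  then show ?thesis using assms(2) by (simp add: max_absorb2)
qed

lemma increment_bound:
  assumes "d > 0 \<or> z = 0" "0 \<le> z" "0 \<le> d" "d \<le> \<rho>"
  shows "z \<le> \<rho> * scale k * (a + b / level k * \<phi> (z / d))"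
proof (cases "z = 0")
  case True
  then show ?thesis
    using assms params scale_pos[of k] level_ge_1[of k] by (simp add: phi_0)
next
  case False
  with assms have d: "d > 0" by simp
  have nn: "a + b / level k * \<phi> (z / d) \<ge> 0"
    using params level_ge_1[of k] class_G_nonneg[OF class_G, of "z / d"] assms by simp
  have "z / (d * scale k) \<le> a + b * (\<phi> (z / (d * scale k) * scale k) / \<phi> (scale k))"
  proof -
    have "\<forall>x\<ge>0. \<forall>y\<ge>phi_inv \<phi> 1. x \<le> a + b * (\<phi> (x * y) / \<phi> y)"
      using class_G unfolding class_G_def by blast
    moreover have "z / (d * scale k) \<ge> 0"
      using assms scale_pos[of k] by simp
    ultimately show ?thesis
      using scale_ge[of k] by blast
  qed
  then have "z / (d * scale k) \<le> a + b / level k * \<phi> (z / d)"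
    using scale_pos[of k] by (simp add: level_def)
  then have "z \<le> d * scale k * (a + b / level k * \<phi> (z / d))"
    using d scale_pos[of k] by (simp add: divide_le_eq mult_ac)
  also have "\<dots> \<le> \<rho> * scale k * (a + b / level k * \<phi> (z / d))"
    using assms nn scale_pos[of k] by (intro mult_right_mono) auto
  finally show ?thesis .
qed

definition lip_const :: real where
  "lip_const = phi_inv \<phi> 1 * (a + b)"

lemma lip_const_nonneg: "lip_const \<ge> 0"
  using params phi_inv_1_pos by (simp add: lip_const_def)

lemma expected_increment_le:
  assumes "dist s t \<le> r"
  shows "(\<integral>\<^sup>+\<omega>. ennreal \<bar>X s \<omega> - X t \<omega>\<bar> \<partial>M) \<le> ennreal (lip_const * r)"
proof -
  interpret M: prob_space M by (rule prob_M)
  let ?h = "\<lambda>\<omega>. \<phi> (\<bar>X s \<omega> - X t \<omega>\<bar> / dist s t)"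
  have r: "r \<ge> 0" using assms zero_le_dist[of s t] by linarith
  have h: "?h \<omega> \<ge> 0" for \<omega> by (intro class_G_nonneg[OF class_G]) simp
  have [measurable]: "?h \<in> borel_measurable M" by (intro phi_comp_measurable) simp_all
  have sc: "scale 0 = phi_inv \<phi> 1" by (simp add: scale_def)
  have "(\<integral>\<^sup>+\<omega>. ennreal \<bar>X s \<omega> - X t \<omega>\<bar> \<partial>M) \<le>
      (\<integral>\<^sup>+\<omega>. ennreal (r * phi_inv \<phi> 1 * a) + ennreal (r * phi_inv \<phi> 1 * b) * ennreal (?h \<omega>) \<partial>M)"
  proof (intro nn_integral_mono)
    fix \<omega>
    have "\<bar>X s \<omega> - X t \<omega>\<bar> \<le> r * scale 0 * (a + b / level 0 * ?h \<omega>)"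
      using assms by (intro increment_bound) auto
    also have "\<dots> = r * phi_inv \<phi> 1 * a + r * phi_inv \<phi> 1 * b * ?h \<omega>"
      by (simp add: sc level_0 algebra_simps)
    finally show "ennreal \<bar>X s \<omega> - X t \<omega>\<bar> \<le>
        ennreal (r * phi_inv \<phi> 1 * a) + ennreal (r * phi_inv \<phi> 1 * b) * ennreal (?h \<omega>)"
      using r h[of \<omega>] params phi_inv_1_pos
      by (simp add: ennreal_leI flip: ennreal_mult ennreal_plus)
  qed
  also have "\<dots> = ennreal (r * phi_inv \<phi> 1 * a) +
      ennreal (r * phi_inv \<phi> 1 * b) * (\<integral>\<^sup>+\<omega>. ennreal (?h \<omega>) \<partial>M)"
    by (simp add: nn_integral_add nn_integral_cmult M.emeasure_space_1)
  also have "\<dots> \<le> ennreal (r * phi_inv \<phi> 1 * a) + ennreal (r * phi_inv \<phi> 1 * b) * 1"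
    by (intro add_left_mono mult_left_mono increment_le_1) simp
  also have "\<dots> = ennreal (lip_const * r)"
    using r params phi_inv_1_pos
    by (simp add: lip_const_def algebra_simps flip: ennreal_plus)
  finally show ?thesis .
qed

text \<open>The process need not be jointly measurable, so it is first made constant on the cells of a
  countable Borel partition of mesh \<open>\<delta>\<close>; this enlarges all radii by \<open>2 * \<delta>\<close>.\<close>

definition fat_rad :: "real \<Rightarrow> nat \<Rightarrow> 'a \<Rightarrow> real" where
  "fat_rad \<delta> k x = rad k x + 2 * \<delta>"

lemma discretized_sup_le:
  fixes V :: ennreal
  assumes \<delta>: "\<delta> > 0" and "a = 0 \<or> R > 2" and F: "finite F"
    and V: "\<And>x. ennreal (a * (R * (R - 1) / (R - 2) * (\<Sum>j<n. scale j * fat_rad \<delta> j x)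
                    + R / (R - 2) * (scale n * fat_rad \<delta> n x))) \<le> V"
  shows "(\<integral>\<^sup>+\<omega>. (SUP s\<in>F. SUP t\<in>F. ennreal \<bar>X s \<omega> - X t \<omega>\<bar>) \<partial>M) \<le>
      2 * (\<Sum>x\<in>F. ennreal (lip_const * \<delta>) + ennreal (lip_const * fat_rad \<delta> n x)) + 2 * V +
      2 * ennreal b * (\<Sum>k<n. ennreal (scale (Suc k)) * (\<integral>\<^sup>+u. ennreal (fat_rad \<delta> k u) \<partial>m))"
proof -
  interpret M: prob_space M by (rule prob_M)
  interpret P: pair_sigma_finite M m ..
  obtain e :: "nat \<Rightarrow> 'a" and N where N [measurable]: "N \<in> measurable m (count_space UNIV)"
      and e: "\<And>x. dist (e (N x)) x < \<delta>"
    using discretization[OF \<delta>] by blast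
  let ?\<rho> = "fat_rad \<delta>"
  define f where "f \<omega> x = X (e (N x)) \<omega>" for \<omega> x
  define h where "h \<omega> u v =
      ennreal (\<phi> (\<bar>f \<omega> u - f \<omega> v\<bar> / dist (e (N u)) (e (N v))))" for \<omega> u v
  define err where "err \<omega> x = ennreal \<bar>X x \<omega> - f \<omega> x\<bar>" for \<omega> x
  define Z where "Z k \<omega> =
      (\<integral>\<^sup>+u. ennreal (?\<rho> k u) * (\<integral>\<^sup>+v. ball_kernel k u v * h \<omega> u v \<partial>m) \<partial>m)" for k \<omega>
  define W where "W \<omega> = ennreal b * (\<Sum>k<n. ennreal (scale (Suc k)) * Z k \<omega>)" for \<omega>
  define E where "E \<omega> x = err \<omega> x + local_osc (f \<omega>) n x" for \<omega> x
  have \<rho>_nonneg: "?\<rho> k x \<ge> 0" for k x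
    using \<delta> rad_nonneg[of k x] by (simp add: fat_rad_def)
  have [measurable]: "?\<rho> k \<in> borel_measurable m" for k
    unfolding fat_rad_def by measurable
  have f_joint: "(\<lambda>z. f (fst z) (snd z)) \<in> borel_measurable (M \<Otimes>\<^sub>M m)"
    unfolding f_def by (rule measurable_compose_countable[where g = "\<lambda>z. N (snd z)"]) measurable
  have f_measurable [measurable]: "f \<omega> \<in> borel_measurable m" for \<omega>
    unfolding f_def by (rule measurable_compose_countable[where g = N]) measurable
  have f_fst [measurable]: "(\<lambda>\<omega>. f \<omega> x) \<in> borel_measurable M" for x
    unfolding f_def by measurable
  have dN [measurable]: "(\<lambda>z. dist (e (N (fst z))) (e (N (snd z)))) \<in> borel_measurable (m \<Otimes>\<^sub>M m)"
    by (rule measurable_compose_countable[where g = "\<lambda>z. N (fst z)"],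
        rule measurable_compose_countable[where g = "\<lambda>z. N (snd z)"]) measurable
  have h_joint: "(\<lambda>z. h (fst z) (fst (snd z)) (snd (snd z))) \<in> borel_measurable (M \<Otimes>\<^sub>M (m \<Otimes>\<^sub>M m))"
  proof -
    have [measurable]: "(\<lambda>z. f (fst z) (fst (snd z))) \<in> borel_measurable (M \<Otimes>\<^sub>M (m \<Otimes>\<^sub>M m))"
      using measurable_compose[OF _ f_joint, of "\<lambda>z. (fst z, fst (snd z))" "M \<Otimes>\<^sub>M (m \<Otimes>\<^sub>M m)"]
      by simp
    have [measurable]: "(\<lambda>z. f (fst z) (snd (snd z))) \<in> borel_measurable (M \<Otimes>\<^sub>M (m \<Otimes>\<^sub>M m))"
      using measurable_compose[OF _ f_joint, of "\<lambda>z. (fst z, snd (snd z))" "M \<Otimes>\<^sub>M (m \<Otimes>\<^sub>M m)"]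
      by simp
    have [measurable]: "(\<lambda>z. dist (e (N (fst (snd z)))) (e (N (snd (snd z)))))
        \<in> borel_measurable (M \<Otimes>\<^sub>M (m \<Otimes>\<^sub>M m))"
      using measurable_compose[OF measurable_snd dN, of M] by simp
    show ?thesis
      unfolding h_def by (intro measurable_compose[OF phi_comp_measurable measurable_ennreal]) auto
  qed
  have h_comp [measurable (raw)]: "(\<lambda>x. h (g1 x) (g2 x) (g3 x)) \<in> borel_measurable L"
    if "g1 \<in> measurable L M" "g2 \<in> measurable L m" "g3 \<in> measurable L m" for g1 g2 g3 and L :: "'z measure"
    using measurable_compose[OF _ h_joint, of "\<lambda>x. (g1 x, g2 x, g3 x)" L] that by simp
  have G_le: "(\<integral>\<^sup>+u. ennreal \<bar>f \<omega> x - f \<omega> u\<bar> \<partial>m) \<le> local_osc (f \<omega>) n x + V + W \<omega>" for \<omega> x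
  proof -
    have "chain_osc (f \<omega>) n x \<le>
        ennreal (a * (R * (R - 1) / (R - 2) * (\<Sum>j<n. phi_inv \<phi> 1 * R ^ j * ?\<rho> j x)
                      + R / (R - 2) * (phi_inv \<phi> 1 * R ^ n * ?\<rho> n x))) +
        ennreal b * (\<Sum>k<n. ennreal (phi_inv \<phi> 1 * R ^ Suc k) *
                      (\<integral>\<^sup>+u. ennreal (?\<rho> k u) * (\<integral>\<^sup>+v. ball_kernel k u v * h \<omega> u v \<partial>m) \<partial>m))"
    proof (rule chain_osc_le[where q = level])
      show "(\<lambda>(u, v). h \<omega> u v) \<in> borel_measurable (m \<Otimes>\<^sub>M m)"
        unfolding case_prod_beta h_def
        by (intro measurable_compose[OF phi_comp_measurable measurable_ennreal]) auto
    next
      fix k u v assume "ball_kernel k u v \<noteq> 0"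
      then have uv: "dist u v \<le> rad k u" by (rule ball_kernel_nonzeroD)
      let ?d = "dist (e (N u)) (e (N v))"
      have "?d \<le> dist (e (N u)) u + dist u v + dist (e (N v)) v"
        by metric
      then have d: "?d \<le> ?\<rho> k u"
        using uv e[of u] e[of v] by (simp add: fat_rad_def)
      have z: "?d > 0 \<or> \<bar>f \<omega> u - f \<omega> v\<bar> = 0"
        by (auto simp: f_def)
      have nn: "\<phi> (\<bar>f \<omega> u - f \<omega> v\<bar> / ?d) \<ge> 0"
        by (intro class_G_nonneg[OF class_G]) simp
      have "\<bar>f \<omega> u - f \<omega> v\<bar> \<le> ?\<rho> k u * scale (Suc k) *
          (a + b / level (Suc k) * \<phi> (\<bar>f \<omega> u - f \<omega> v\<bar> / ?d))"
        using z d by (intro increment_bound) auto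
      then have "ennreal \<bar>f \<omega> u - f \<omega> v\<bar> \<le> ennreal (?\<rho> k u * scale (Suc k) *
          (a + b / level (Suc k) * \<phi> (\<bar>f \<omega> u - f \<omega> v\<bar> / ?d)))"
        by (rule ennreal_leI)
      also have "\<dots> = ennreal (?\<rho> k u * scale (Suc k)) * (ennreal a +
          ennreal (b / level (Suc k)) * h \<omega> u v)"
        unfolding h_def
        using nn params \<rho>_nonneg[of k u] scale_pos[of "Suc k"] level_ge_1[of "Suc k"]
        by (subst ennreal_mult'[symmetric], simp, subst ennreal_plus[symmetric], simp_all add: ennreal_mult)
      finally show "ennreal \<bar>f \<omega> u - f \<omega> v\<bar> \<le>
          ennreal (?\<rho> k u * (phi_inv \<phi> 1 * R ^ Suc k)) *
            (ennreal a + ennreal (b / level (Suc k)) * h \<omega> u v)"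
        by (simp add: scale_def)
    next
      fix j k x u assume "ball_kernel k x u \<noteq> 0"
      then have "dist x u \<le> rad k x" by (rule ball_kernel_nonzeroD)
      then show "?\<rho> j u \<le> ?\<rho> j x + ?\<rho> k x"
        using rad_lipschitz[of j u x] \<delta> by (simp add: fat_rad_def)
    qed (use params assms phi_inv_1_pos level_ge_1 ball_kernel_le \<rho>_nonneg in
        \<open>auto intro: less_le_trans[OF zero_less_one]\<close>)
    also have "\<dots> \<le> V + W \<omega>"
      using V[of x] by (auto simp: W_def Z_def scale_def intro!: add_right_mono)
    finally have "chain_osc (f \<omega>) n x \<le> V + W \<omega>" .
    then show ?thesis
      using integral_osc_le_chain[OF f_measurable, of \<omega> x n]
      by (simp add: add.assoc) (metis (no_types, lifting) add_left_mono order_trans)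
  qed
  have f_diff_le: "ennreal \<bar>f \<omega> s - f \<omega> t\<bar> \<le>
      (local_osc (f \<omega>) n s + V + W \<omega>) + (local_osc (f \<omega>) n t + V + W \<omega>)" for \<omega> s t
  proof -
    have "ennreal \<bar>f \<omega> s - f \<omega> t\<bar> = (\<integral>\<^sup>+u. ennreal \<bar>f \<omega> s - f \<omega> t\<bar> \<partial>m)"
      by (simp add: emeasure_space_1[simplified])
    also have "\<dots> \<le> (\<integral>\<^sup>+u. ennreal \<bar>f \<omega> s - f \<omega> u\<bar> + ennreal \<bar>f \<omega> t - f \<omega> u\<bar> \<partial>m)"
      by (intro nn_integral_mono) (auto simp flip: ennreal_plus intro!: ennreal_leI)
    also have "\<dots> = (\<integral>\<^sup>+u. ennreal \<bar>f \<omega> s - f \<omega> u\<bar> \<partial>m) + (\<integral>\<^sup>+u. ennreal \<bar>f \<omega> t - f \<omega> u\<bar> \<partial>m)"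
      by (intro nn_integral_add) simp_all
    also have "\<dots> \<le> (local_osc (f \<omega>) n s + V + W \<omega>) + (local_osc (f \<omega>) n t + V + W \<omega>)"
      by (intro add_mono G_le)
    finally show ?thesis .
  qed
  have X_diff_le: "ennreal \<bar>X s \<omega> - X t \<omega>\<bar> \<le> 2 * (\<Sum>x\<in>F. E \<omega> x) + 2 * V + 2 * W \<omega>"
    if "s \<in> F" "t \<in> F" for s t \<omega>
  proof -
    have "ennreal \<bar>X s \<omega> - X t \<omega>\<bar> \<le> ennreal (\<bar>X s \<omega> - f \<omega> s\<bar> + \<bar>f \<omega> s - f \<omega> t\<bar> + \<bar>X t \<omega> - f \<omega> t\<bar>)"
      by (intro ennreal_leI) linarith
    also have "\<dots> = err \<omega> s + ennreal \<bar>f \<omega> s - f \<omega> t\<bar> + err \<omega> t"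
      by (simp add: err_def)
    also have "\<dots> \<le> err \<omega> s + ((local_osc (f \<omega>) n s + V + W \<omega>) + (local_osc (f \<omega>) n t + V + W \<omega>)) + err \<omega> t"
      by (intro add_mono f_diff_le order_refl)
    also have "\<dots> = E \<omega> s + E \<omega> t + 2 * V + 2 * W \<omega>"
      by (simp add: E_def mult_2 add_ac)
    also have "\<dots> \<le> (\<Sum>x\<in>F. E \<omega> x) + (\<Sum>x\<in>F. E \<omega> x) + 2 * V + 2 * W \<omega>"
      using F that by (intro add_mono order_refl member_le_sum) auto
    finally show ?thesis by (simp add: mult_2)
  qed
  have [measurable]: "(\<lambda>\<omega>. err \<omega> x) \<in> borel_measurable M" for x
    unfolding err_def by measurable
  have f_diff_joint: "(\<lambda>z. ennreal \<bar>f (fst z) x - f (fst z) (snd z)\<bar>) \<in> borel_measurable (M \<Otimes>\<^sub>M m)" for x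
    using f_joint by measurable
  have osc_joint: "(\<lambda>z. ball_kernel k x (snd z) * ennreal \<bar>f (fst z) x - f (fst z) (snd z)\<bar>)
      \<in> borel_measurable (M \<Otimes>\<^sub>M m)" for k x
    using f_diff_joint by measurable
  have [measurable]: "(\<lambda>\<omega>. local_osc (f \<omega>) n x) \<in> borel_measurable M" for x
    unfolding local_osc_def
    by (rule borel_measurable_nn_integral) (use osc_joint[of n x] in \<open>simp add: case_prod_beta\<close>)
  have kh_joint: "(\<lambda>z. ball_kernel k u (snd z) * h (fst z) u (snd z)) \<in> borel_measurable (M \<Otimes>\<^sub>M m)" for k u
    by measurable
  have inner_joint: "(\<lambda>z. ennreal (?\<rho> k (snd z)) * (\<integral>\<^sup>+v. ball_kernel k (snd z) v * h (fst z) (snd z) v \<partial>m))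
      \<in> borel_measurable (M \<Otimes>\<^sub>M m)" for k
    by measurable
  have [measurable]: "Z k \<in> borel_measurable M" for k
    unfolding Z_def
    by (rule borel_measurable_nn_integral) (use inner_joint[of k] in \<open>simp add: case_prod_beta\<close>)
  have Z_le: "(\<integral>\<^sup>+\<omega>. Z k \<omega> \<partial>M) \<le> (\<integral>\<^sup>+u. ennreal (?\<rho> k u) \<partial>m)" for k
  proof -
    have "(\<integral>\<^sup>+\<omega>. Z k \<omega> \<partial>M) =
        (\<integral>\<^sup>+u. (\<integral>\<^sup>+\<omega>. ennreal (?\<rho> k u) * (\<integral>\<^sup>+v. ball_kernel k u v * h \<omega> u v \<partial>m) \<partial>M) \<partial>m)"
      unfolding Z_def using inner_joint[of k] by (subst P.Fubini') (simp_all add: case_prod_beta)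
    also have "\<dots> \<le> (\<integral>\<^sup>+u. ennreal (?\<rho> k u) \<partial>m)"
    proof (intro nn_integral_mono)
      fix u
      have "(\<integral>\<^sup>+\<omega>. ennreal (?\<rho> k u) * (\<integral>\<^sup>+v. ball_kernel k u v * h \<omega> u v \<partial>m) \<partial>M) =
          ennreal (?\<rho> k u) * (\<integral>\<^sup>+\<omega>. (\<integral>\<^sup>+v. ball_kernel k u v * h \<omega> u v \<partial>m) \<partial>M)"
        by (intro nn_integral_cmult) measurable
      also have "(\<integral>\<^sup>+\<omega>. (\<integral>\<^sup>+v. ball_kernel k u v * h \<omega> u v \<partial>m) \<partial>M) =
          (\<integral>\<^sup>+v. (\<integral>\<^sup>+\<omega>. ball_kernel k u v * h \<omega> u v \<partial>M) \<partial>m)"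
        using kh_joint[of k u] by (subst P.Fubini') (simp_all add: case_prod_beta)
      also have "\<dots> = (\<integral>\<^sup>+v. ball_kernel k u v * (\<integral>\<^sup>+\<omega>. h \<omega> u v \<partial>M) \<partial>m)"
        by (intro nn_integral_cong nn_integral_cmult) measurable
      also have "\<dots> \<le> (\<integral>\<^sup>+v. ball_kernel k u v * 1 \<partial>m)"
        unfolding h_def f_def by (intro nn_integral_mono mult_left_mono increment_le_1) simp
      also have "\<dots> = 1" by (rule kernel_integral_const)
      finally show "(\<integral>\<^sup>+\<omega>. ennreal (?\<rho> k u) * (\<integral>\<^sup>+v. ball_kernel k u v * h \<omega> u v \<partial>m) \<partial>M) \<le> ennreal (?\<rho> k u)"
        by (simp add: mult_left_mono)
    qed
    finally show ?thesis .
  qed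
  have err_le: "(\<integral>\<^sup>+\<omega>. err \<omega> x \<partial>M) \<le> ennreal (lip_const * \<delta>)" for x
    unfolding err_def f_def using e[of x] by (intro expected_increment_le) (simp add: dist_commute)
  have osc_le: "(\<integral>\<^sup>+\<omega>. local_osc (f \<omega>) n x \<partial>M) \<le> ennreal (lip_const * ?\<rho> n x)" for x
  proof -
    have "(\<integral>\<^sup>+\<omega>. local_osc (f \<omega>) n x \<partial>M) =
        (\<integral>\<^sup>+u. (\<integral>\<^sup>+\<omega>. ball_kernel n x u * ennreal \<bar>f \<omega> x - f \<omega> u\<bar> \<partial>M) \<partial>m)"
      unfolding local_osc_def using osc_joint[of n x] by (subst P.Fubini') (simp_all add: case_prod_beta)
    also have "\<dots> \<le> (\<integral>\<^sup>+u. ball_kernel n x u * ennreal (lip_const * ?\<rho> n x) \<partial>m)"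
    proof (intro nn_integral_mono)
      fix u
      have "(\<integral>\<^sup>+\<omega>. ball_kernel n x u * ennreal \<bar>f \<omega> x - f \<omega> u\<bar> \<partial>M) =
          ball_kernel n x u * (\<integral>\<^sup>+\<omega>. ennreal \<bar>f \<omega> x - f \<omega> u\<bar> \<partial>M)"
        by (intro nn_integral_cmult) measurable
      also have "\<dots> \<le> ball_kernel n x u * ennreal (lip_const * ?\<rho> n x)"
      proof (cases "ball_kernel n x u = 0")
        case False
        then have "dist x u \<le> rad n x" by (rule ball_kernel_nonzeroD)
        moreover have "dist (e (N x)) (e (N u)) \<le> dist (e (N x)) x + dist x u + dist (e (N u)) u"
          by metric
        ultimately have "dist (e (N x)) (e (N u)) \<le> ?\<rho> n x"
          using e[of x] e[of u] by (simp add: fat_rad_def)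
        then show ?thesis
          unfolding f_def by (intro mult_left_mono expected_increment_le) auto
      qed simp
      finally show "(\<integral>\<^sup>+\<omega>. ball_kernel n x u * ennreal \<bar>f \<omega> x - f \<omega> u\<bar> \<partial>M) \<le>
          ball_kernel n x u * ennreal (lip_const * ?\<rho> n x)" .
    qed
    also have "\<dots> = ennreal (lip_const * ?\<rho> n x)" by (rule kernel_integral_const)
    finally show ?thesis .
  qed
  have "(\<integral>\<^sup>+\<omega>. (SUP s\<in>F. SUP t\<in>F. ennreal \<bar>X s \<omega> - X t \<omega>\<bar>) \<partial>M) \<le>
      (\<integral>\<^sup>+\<omega>. 2 * (\<Sum>x\<in>F. E \<omega> x) + 2 * V + 2 * W \<omega> \<partial>M)"
    by (intro nn_integral_mono SUP_least X_diff_le)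
  also have "\<dots> = 2 * (\<Sum>x\<in>F. (\<integral>\<^sup>+\<omega>. err \<omega> x \<partial>M) + (\<integral>\<^sup>+\<omega>. local_osc (f \<omega>) n x \<partial>M)) + 2 * V +
      2 * (ennreal b * (\<Sum>k<n. ennreal (scale (Suc k)) * (\<integral>\<^sup>+\<omega>. Z k \<omega> \<partial>M)))"
    unfolding E_def W_def
    by (simp add: nn_integral_add nn_integral_cmult nn_integral_sum M.emeasure_space_1)
  also have "\<dots> \<le> 2 * (\<Sum>x\<in>F. ennreal (lip_const * \<delta>) + ennreal (lip_const * ?\<rho> n x)) + 2 * V +
      2 * (ennreal b * (\<Sum>k<n. ennreal (scale (Suc k)) * (\<integral>\<^sup>+u. ennreal (?\<rho> k u) \<partial>m)))"
    by (intro add_mono mult_left_mono sum_mono err_le osc_le Z_le order_refl) auto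
  finally show ?thesis by (simp add: mult.assoc)
qed

lemma weighted_fat_rad_le_S:
  assumes "\<delta> > 0" "a = 0 \<or> R > 2"
  shows "ennreal (a * (R * (R - 1) / (R - 2) * (\<Sum>j<n. scale j * fat_rad \<delta> j x)
                    + R / (R - 2) * (scale n * fat_rad \<delta> n x)))
    \<le> ennreal a * ennreal (R ^ 3 / ((R - 1) * (R - 2))) * mm_S \<phi> m
      + ennreal (\<delta> * (2 * a * (R\<^sup>2 / (R - 2)) * (\<Sum>j<Suc n. scale j)))"
proof (cases "a = 0")
  case False
  with assms have R: "R > 2" by simp
  define K where "K = R\<^sup>2 / (R - 2)"
  define A where "A = R ^ 3 / ((R - 1) * (R - 2))"
  have K: "K \<ge> 0" "A \<ge> 0" "1 - 1 / R \<ge> 0"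
    using R by (auto simp: K_def A_def)
  have KA: "K = A * (1 - 1 / R)"
  proof -
    have "1 - 1 / R = (R - 1) / R" using R by (simp add: field_simps)
    then show ?thesis
      using R by (simp add: K_def A_def power2_eq_square power3_eq_cube)
  qed
  have le: "R * (R - 1) / (R - 2) \<le> K" "R / (R - 2) \<le> K"
    using R unfolding K_def by (intro divide_right_mono; simp add: power2_eq_square algebra_simps)+
  let ?s = "\<Sum>j<Suc n. scale j * rad j x"
  have nn: "scale j * fat_rad \<delta> j x \<ge> 0" "scale j * rad j x \<ge> 0" for j
    using scale_pos[of j] rad_nonneg[of j x] assms by (auto simp: fat_rad_def)
  have s_nonneg: "?s \<ge> 0" "(\<Sum>j<Suc n. scale j) \<ge> 0"
    using nn(2) scale_pos by (intro sum_nonneg; simp add: less_imp_le)+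
  have "R * (R - 1) / (R - 2) * (\<Sum>j<n. scale j * fat_rad \<delta> j x)
      + R / (R - 2) * (scale n * fat_rad \<delta> n x)
    \<le> K * (\<Sum>j<n. scale j * fat_rad \<delta> j x) + K * (scale n * fat_rad \<delta> n x)"
    by (intro add_mono mult_right_mono le sum_nonneg nn)
  also have "\<dots> = K * ?s + K * (\<Sum>j<Suc n. scale j * (2 * \<delta>))"
    by (simp add: fat_rad_def sum.distrib algebra_simps)
  also have "\<dots> = A * ((1 - 1 / R) * ?s) + \<delta> * (2 * K * (\<Sum>j<Suc n. scale j))"
  proof -
    have "K * ?s = A * ((1 - 1 / R) * ?s)" by (simp only: KA mult.assoc)
    moreover have "K * (\<Sum>j<Suc n. scale j * (2 * \<delta>)) = \<delta> * (2 * K * (\<Sum>j<Suc n. scale j))"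
      unfolding sum_distrib_right[symmetric] by (simp only: mult_ac)
    ultimately show ?thesis by (simp only:)
  qed
  finally have "a * (R * (R - 1) / (R - 2) * (\<Sum>j<n. scale j * fat_rad \<delta> j x)
      + R / (R - 2) * (scale n * fat_rad \<delta> n x))
    \<le> a * (A * ((1 - 1 / R) * ?s) + \<delta> * (2 * K * (\<Sum>j<Suc n. scale j)))"
    using params by (intro mult_left_mono)
  also have "\<dots> = a * A * ((1 - 1 / R) * ?s) + \<delta> * (2 * a * K * (\<Sum>j<Suc n. scale j))"
    by (simp add: algebra_simps del: sum.lessThan_Suc)
  finally have "ennreal (a * (R * (R - 1) / (R - 2) * (\<Sum>j<n. scale j * fat_rad \<delta> j x)
      + R / (R - 2) * (scale n * fat_rad \<delta> n x)))
    \<le> ennreal (a * A * ((1 - 1 / R) * ?s) + \<delta> * (2 * a * K * (\<Sum>j<Suc n. scale j)))"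
    by (rule ennreal_leI)
  also have "\<dots> = ennreal (a * A * ((1 - 1 / R) * ?s)) + ennreal (\<delta> * (2 * a * K * (\<Sum>j<Suc n. scale j)))"
    using params K s_nonneg assms(1) by (intro ennreal_plus mult_nonneg_nonneg) auto
  also have "ennreal (a * A * ((1 - 1 / R) * ?s)) = ennreal a * ennreal A * (ennreal (1 - 1 / R) * ennreal ?s)"
    using params(1) K s_nonneg by (simp only: ennreal_mult mult_nonneg_nonneg)
  also have "ennreal ?s = (\<Sum>j<Suc n. ennreal (scale j) * ennreal (rad j x))"
    using nn(2) scale_pos rad_nonneg
    by (subst sum_ennreal[symmetric]) (auto simp: ennreal_mult less_imp_le simp del: sum.lessThan_Suc)
  also have "ennreal a * ennreal A *
      (ennreal (1 - 1 / R) * (\<Sum>j<Suc n. ennreal (scale j) * ennreal (rad j x)))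
      + ennreal (\<delta> * (2 * a * K * (\<Sum>j<Suc n. scale j)))
    \<le> ennreal a * ennreal A * mm_S \<phi> m + ennreal (\<delta> * (2 * a * K * (\<Sum>j<Suc n. scale j)))"
    unfolding mm_S_def by (intro add_right_mono mult_left_mono SUP_upper2[of x] sum_rad_le_sigma) auto
  finally show ?thesis by (simp only: A_def K_def)
qed simp

lemma weighted_fat_rad_integral_le_S_bar:
  assumes "\<delta> > 0"
  shows "(\<Sum>k<n. ennreal (scale (Suc k)) * (\<integral>\<^sup>+u. ennreal (fat_rad \<delta> k u) \<partial>m))
    \<le> ennreal (R\<^sup>2 / (R - 1)) * mm_S_bar \<phi> m + ennreal (\<delta> * (2 * R * (\<Sum>k<n. scale k)))"
proof -
  have R: "R = R\<^sup>2 / (R - 1) * (1 - 1 / R)" "R\<^sup>2 / (R - 1) \<ge> 0" "1 - 1 / R \<ge> 0"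
    using params by (auto simp: field_simps power2_eq_square)
  have "(\<Sum>k<n. ennreal (scale (Suc k)) * (\<integral>\<^sup>+u. ennreal (fat_rad \<delta> k u) \<partial>m)) =
      (\<Sum>k<n. ennreal R * (ennreal (scale k) * (\<integral>\<^sup>+u. ennreal (rad k u) \<partial>m)) + ennreal (\<delta> * (2 * R * scale k)))"
  proof (intro sum.cong refl)
    fix k
    have "(\<integral>\<^sup>+u. ennreal (fat_rad \<delta> k u) \<partial>m) = (\<integral>\<^sup>+u. ennreal (rad k u) + ennreal (2 * \<delta>) \<partial>m)"
      unfolding fat_rad_def using assms rad_nonneg by (intro nn_integral_cong ennreal_plus) auto
    also have "\<dots> = (\<integral>\<^sup>+u. ennreal (rad k u) \<partial>m) + ennreal (2 * \<delta>)"
      by (simp add: nn_integral_add emeasure_space_1[simplified])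
    finally have eq: "(\<integral>\<^sup>+u. ennreal (fat_rad \<delta> k u) \<partial>m) =
        (\<integral>\<^sup>+u. ennreal (rad k u) \<partial>m) + ennreal (2 * \<delta>)" .
    have sc: "scale (Suc k) = R * scale k" by (simp add: scale_def)
    show "ennreal (scale (Suc k)) * (\<integral>\<^sup>+u. ennreal (fat_rad \<delta> k u) \<partial>m) =
        ennreal R * (ennreal (scale k) * (\<integral>\<^sup>+u. ennreal (rad k u) \<partial>m)) + ennreal (\<delta> * (2 * R * scale k))"
    proof -
      have "ennreal (R * scale k) = ennreal R * ennreal (scale k)"
        using params scale_pos[of k] by (intro ennreal_mult) auto
      moreover have "ennreal (R * scale k) * ennreal (2 * \<delta>) = ennreal (\<delta> * (2 * R * scale k))"
        using assms params scale_pos[of k] by (subst ennreal_mult[symmetric]) (auto simp: mult_ac)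
      ultimately show ?thesis
        unfolding eq sc by (simp add: distrib_left mult.assoc)
    qed
  qed
  also have "\<dots> = ennreal R * (\<integral>\<^sup>+u. (\<Sum>k<n. ennreal (scale k) * ennreal (rad k u)) \<partial>m)
      + ennreal (\<delta> * (2 * R * (\<Sum>k<n. scale k)))"
  proof -
    have "(\<integral>\<^sup>+u. (\<Sum>k<n. ennreal (scale k) * ennreal (rad k u)) \<partial>m) =
        (\<Sum>k<n. ennreal (scale k) * (\<integral>\<^sup>+u. ennreal (rad k u) \<partial>m))"
      by (simp add: nn_integral_sum nn_integral_cmult)
    moreover have "(\<Sum>k<n. ennreal (\<delta> * (2 * R * scale k))) = ennreal (\<delta> * (2 * R * (\<Sum>k<n. scale k)))"
      using assms params scale_pos by (subst sum_ennreal) (auto simp: sum_distrib_left less_imp_le)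
    ultimately show ?thesis by (simp add: sum.distrib sum_distrib_left)
  qed
  also have "ennreal R * (\<integral>\<^sup>+u. (\<Sum>k<n. ennreal (scale k) * ennreal (rad k u)) \<partial>m) =
      ennreal (R\<^sup>2 / (R - 1)) *
        (\<integral>\<^sup>+u. ennreal (1 - 1 / R) * (\<Sum>k<n. ennreal (scale k) * ennreal (rad k u)) \<partial>m)"
    by (subst R(1), subst ennreal_mult[OF R(2,3)]) (simp add: nn_integral_cmult mult.assoc)
  also have "\<dots> \<le> ennreal (R\<^sup>2 / (R - 1)) * mm_S_bar \<phi> m"
    unfolding mm_S_bar_def by (intro mult_left_mono nn_integral_mono sum_rad_le_sigma) simp
  finally show ?thesis by (simp add: add_right_mono)
qed

lemma finite_sup_le:
  assumes "a = 0 \<or> R > 2" and F: "finite F"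
  shows "(\<integral>\<^sup>+\<omega>. (SUP s\<in>F. SUP t\<in>F. ennreal \<bar>X s \<omega> - X t \<omega>\<bar>) \<partial>M) \<le>
      2 * ennreal a * ennreal (R ^ 3 / ((R - 1) * (R - 2))) * mm_S \<phi> m
      + 2 * ennreal b * ennreal (R\<^sup>2 / (R - 1)) * mm_S_bar \<phi> m" (is "?L \<le> ?T")
proof (rule ennreal_le_epsilon)
  fix \<epsilon> :: real assume "\<epsilon> > 0"
  define A where "A = ennreal (R ^ 3 / ((R - 1) * (R - 2)))"
  define B where "B = ennreal (R\<^sup>2 / (R - 1))"
  define c where "c n = 2 * a * (R\<^sup>2 / (R - 2)) * (\<Sum>j<Suc n. scale j)" for n
  define d where "d n = 2 * R * (\<Sum>k<n. scale k)" for n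
  have nn: "c n \<ge> 0" "d n \<ge> 0" for n
    unfolding c_def d_def using params scale_pos
    by (intro mult_nonneg_nonneg sum_nonneg divide_nonneg_nonneg; simp add: less_imp_le)+
  have "(\<lambda>n. 2 * lip_const * (\<Sum>x\<in>F. rad n x)) \<longlonglongrightarrow> 2 * lip_const * (\<Sum>x\<in>F. 0)"
    by (intro tendsto_intros rad_tendsto_0)
  then have "eventually (\<lambda>n. 2 * lip_const * (\<Sum>x\<in>F. rad n x) < \<epsilon> / 2) sequentially"
    using \<open>\<epsilon> > 0\<close> by (intro order_tendstoD) auto
  then obtain n where n: "2 * lip_const * (\<Sum>x\<in>F. rad n x) < \<epsilon> / 2"
    by (auto simp: eventually_sequentially)
  define Q where "Q = 6 * lip_const * real (card F) + 2 * c n + 2 * b * d n"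
  have Q: "Q \<ge> 0" unfolding Q_def using nn lip_const_nonneg params by simp
  define \<delta> where "\<delta> = \<epsilon> / 2 / (1 + Q)"
  have \<delta>: "\<delta> > 0" using \<open>\<epsilon> > 0\<close> Q by (simp add: \<delta>_def)
  have \<delta>Q: "\<delta> * Q \<le> \<epsilon> / 2"
    using \<open>\<epsilon> > 0\<close> Q by (simp add: \<delta>_def field_simps)
  have "?L \<le>
      2 * (\<Sum>x\<in>F. ennreal (lip_const * \<delta>) + ennreal (lip_const * fat_rad \<delta> n x)) +
      2 * (ennreal a * A * mm_S \<phi> m + ennreal (\<delta> * c n)) +
      2 * ennreal b * (\<Sum>k<n. ennreal (scale (Suc k)) * (\<integral>\<^sup>+u. ennreal (fat_rad \<delta> k u) \<partial>m))"
    unfolding A_def c_def using \<delta> assms by (intro discretized_sup_le weighted_fat_rad_le_S)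
  also have "\<dots> \<le> 2 * (\<Sum>x\<in>F. ennreal (lip_const * \<delta>) + ennreal (lip_const * fat_rad \<delta> n x)) +
      2 * (ennreal a * A * mm_S \<phi> m + ennreal (\<delta> * c n)) +
      2 * ennreal b * (B * mm_S_bar \<phi> m + ennreal (\<delta> * d n))"
    unfolding B_def d_def
    by (intro add_left_mono mult_left_mono weighted_fat_rad_integral_le_S_bar \<delta>) simp
  also have "(\<Sum>x\<in>F. ennreal (lip_const * \<delta>) + ennreal (lip_const * fat_rad \<delta> n x)) =
      ennreal (lip_const * (\<Sum>x\<in>F. rad n x) + 3 * lip_const * card F * \<delta>)"
  proof -
    have "(\<Sum>x\<in>F. ennreal (lip_const * \<delta>) + ennreal (lip_const * fat_rad \<delta> n x)) =
        (\<Sum>x\<in>F. ennreal (lip_const * \<delta> + lip_const * fat_rad \<delta> n x))"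
      using lip_const_nonneg \<delta> rad_nonneg[of n]
      by (intro sum.cong refl ennreal_plus[symmetric]) (auto simp: fat_rad_def)
    also have "\<dots> = ennreal (\<Sum>x\<in>F. lip_const * \<delta> + lip_const * fat_rad \<delta> n x)"
      using lip_const_nonneg \<delta> rad_nonneg[of n]
      by (intro sum_ennreal) (auto simp: fat_rad_def)
    also have "(\<Sum>x\<in>F. lip_const * \<delta> + lip_const * fat_rad \<delta> n x) =
        lip_const * (\<Sum>x\<in>F. rad n x) + 3 * lip_const * card F * \<delta>"
      by (simp add: fat_rad_def sum.distrib algebra_simps flip: sum_distrib_left)
    finally show ?thesis .
  qed
  also have "2 * ennreal (lip_const * (\<Sum>x\<in>F. rad n x) + 3 * lip_const * card F * \<delta>) +
      2 * (ennreal a * A * mm_S \<phi> m + ennreal (\<delta> * c n)) +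
      2 * ennreal b * (B * mm_S_bar \<phi> m + ennreal (\<delta> * d n)) =
      ?T + (2 * ennreal (lip_const * (\<Sum>x\<in>F. rad n x) + 3 * lip_const * card F * \<delta>)
        + 2 * ennreal (\<delta> * c n) + 2 * ennreal b * ennreal (\<delta> * d n))"
    by (simp add: A_def B_def distrib_left mult.assoc add_ac)
  also have "2 * ennreal (lip_const * (\<Sum>x\<in>F. rad n x) + 3 * lip_const * card F * \<delta>)
        + 2 * ennreal (\<delta> * c n) + 2 * ennreal b * ennreal (\<delta> * d n) =
      ennreal (2 * lip_const * (\<Sum>x\<in>F. rad n x) + \<delta> * Q)"
  proof -
    have s: "(\<Sum>x\<in>F. rad n x) \<ge> 0" by (intro sum_nonneg rad_nonneg)
    have collect: "2 * ennreal p + 2 * ennreal q + 2 * ennreal b * ennreal r =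
        ennreal (2 * p + 2 * q + 2 * b * r)" if "p \<ge> 0" "q \<ge> 0" "r \<ge> 0" for p q r
      using that params by (simp add: ennreal_mult ennreal_plus mult.assoc)
    have "2 * ennreal (lip_const * (\<Sum>x\<in>F. rad n x) + 3 * lip_const * card F * \<delta>)
        + 2 * ennreal (\<delta> * c n) + 2 * ennreal b * ennreal (\<delta> * d n) =
      ennreal (2 * (lip_const * (\<Sum>x\<in>F. rad n x) + 3 * lip_const * card F * \<delta>)
        + 2 * (\<delta> * c n) + 2 * b * (\<delta> * d n))"
      using s lip_const_nonneg \<delta> nn[of n] by (intro collect) auto
    also have "2 * (lip_const * (\<Sum>x\<in>F. rad n x) + 3 * lip_const * card F * \<delta>)
        + 2 * (\<delta> * c n) + 2 * b * (\<delta> * d n) = 2 * lip_const * (\<Sum>x\<in>F. rad n x) + \<delta> * Q"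
      by (simp add: Q_def algebra_simps)
    finally show ?thesis .
  qed
  also have "?T + \<dots> \<le> ?T + ennreal \<epsilon>"
    using n \<delta>Q by (intro add_left_mono ennreal_leI) linarith
  finally show "?L \<le> ?T + ennreal \<epsilon>" .
qed

end

theorem theorem3p1:
  fixes m :: "'a::metric_space measure"
    and a b R B :: real
    and A :: ennreal
    and \<phi> :: "real \<Rightarrow> real"
    and M :: "'w measure"
    and X :: "'a \<Rightarrow> 'w \<Rightarrow> real"
  assumes "prob_space m" and "sets m = sets borel" and "measure_support m = UNIV"
    and "a \<ge> 0" and "b \<ge> 0"
    and "\<phi> \<in> class_G a b" and "young_function \<phi>"
    and "R \<ge> 2"
    and "A = (if R = 2 then \<infinity> else ennreal (R ^ 3 / ((R - 1) * (R - 2))))"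
    and "B = R ^ 2 / (R - 1)"
    and "prob_space M" and "\<And>t. X t \<in> borel_measurable M"
    and "separable_process M X"
    and "(SUP s. SUP t. \<integral>\<^sup>+\<omega>. ennreal (\<phi> (\<bar>X s \<omega> - X t \<omega>\<bar> / dist s t)) \<partial>M) \<le> 1"
  shows "expected_sup_increment M X
           \<le> 2 * ennreal a * A * mm_S \<phi> m + 2 * ennreal b * ennreal B * mm_S_bar \<phi> m"
proof -
  interpret m: prob_space m by fact
  interpret full_support_prob m
  proof
    show "emeasure m U > 0" if "open U" "U \<noteq> {}" for U
      using that assms(3) unfolding measure_support_def by blast
  qed fact
  let ?w = "phi_inv \<phi> 1"
  let ?T = "2 * ennreal a * A * mm_S \<phi> m + 2 * ennreal b * ennreal B * mm_S_bar \<phi> m"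
  have w: "?w > 0"
    using class_G_phi_inv[OF assms(6), of 1] assms(6)
    by (cases "?w = 0") (auto simp: class_G_def)
  have b: "b > 0"
  proof (rule ccontr)
    assume "\<not> b > 0"
    with assms(5) have "b = 0" by simp
    moreover have "\<forall>x\<ge>0. \<forall>y\<ge>?w. x \<le> a + b * (\<phi> (x * y) / \<phi> y)"
      using assms(6) unfolding class_G_def by blast
    ultimately have "a + 1 \<le> a"
      using assms(4) by (auto dest!: spec[of _ "a + 1"])
    then show False by simp
  qed
  have B: "B > 0" using assms by simp
  show ?thesis
  proof (cases "mm_S_bar \<phi> m = \<infinity>")
    case True
    then have "?T = \<infinity>"
      using b B by (simp add: ennreal_mult_eq_top_iff ennreal_eq_0_iff)
    then show ?thesis by (simp only: infinity_ennreal_def top_greatest)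
  next
    case False
    have "ennreal ?w * ennreal (dist s t) \<le> mm_S_bar \<phi> m" for s t :: 'a
    proof -
      have "ennreal ?w * ennreal (dist s t) = (\<integral>\<^sup>+u. ennreal ?w * ennreal (dist s t) \<partial>m)"
        by (simp add: m.emeasure_space_1[simplified])
      also have "\<dots> \<le> mm_S_bar \<phi> m"
        unfolding mm_S_bar_def by (intro nn_integral_mono dist_le_sigma[OF assms(6)])
      finally show ?thesis .
    qed
    then have "ennreal (1 / ?w) * (ennreal ?w * ennreal (dist s t)) \<le> ennreal (1 / ?w) * mm_S_bar \<phi> m"
      for s t :: 'a
      by (intro mult_left_mono) auto
    then have dist_le: "ennreal (dist s t) \<le> ennreal (1 / ?w) * mm_S_bar \<phi> m" for s t :: 'a
      using w by (simp flip: mult.assoc ennreal_mult)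
    have "ediameter (UNIV :: 'a set) \<le> ennreal (1 / ?w) * mm_S_bar \<phi> m"
      unfolding ediameter_def by (intro SUP_least dist_le)
    also have "\<dots> < \<infinity>"
      using False by (simp add: ennreal_mult_less_top less_top)
    finally have diam: "ediameter (UNIV :: 'a set) = ennreal (enn2real (ediameter (UNIV :: 'a set)))"
      by simp
    have incr: "(\<integral>\<^sup>+\<omega>. ennreal (\<phi> (\<bar>X s \<omega> - X t \<omega>\<bar> / dist s t)) \<partial>M) \<le> 1" for s t
      using assms(14) by (auto simp: SUP_le_iff)
    interpret bounded_increments m \<phi> a b R "enn2real (ediameter (UNIV :: 'a set))" M X
      by (intro bounded_increments.intro majorizing_setup.intro bounded_increments_axioms.intro
          majorizing_setup_axioms.intro full_support_prob_axioms assms diam incr enn2real_nonneg)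
    have "(\<integral>\<^sup>+\<omega>. (SUP s\<in>F. SUP t\<in>F. ennreal \<bar>X s \<omega> - X t \<omega>\<bar>) \<partial>M) \<le> ?T" if F: "finite F" for F
    proof (cases "a = 0 \<or> R > 2")
      case True
      then show ?thesis
        using finite_sup_le[OF True F] assms(9,10) by auto
    next
      case False
      then have aR: "a > 0" "A = \<infinity>" using assms by auto
      show ?thesis
      proof (cases "mm_S \<phi> m = 0")
        case True
        have "s = t" for s t :: 'a
        proof -
          have "ennreal ?w * ennreal (dist s t) \<le> mm_S \<phi> m"
            unfolding mm_S_def by (intro SUP_upper2[of s] dist_le_sigma[OF assms(6)]) simp
          then show ?thesis using True w by (simp flip: ennreal_mult)
        qed
        then have "\<bar>X s \<omega> - X t \<omega>\<bar> = 0" for s t \<omega> by (metis abs_zero diff_self)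
        then have "(SUP s\<in>F. SUP t\<in>F. ennreal \<bar>X s \<omega> - X t \<omega>\<bar>) \<le> 0" for \<omega>
          by (intro SUP_least) (simp only: ennreal_0 order_refl)
        then have "(\<integral>\<^sup>+\<omega>. (SUP s\<in>F. SUP t\<in>F. ennreal \<bar>X s \<omega> - X t \<omega>\<bar>) \<partial>M) \<le> (\<integral>\<^sup>+\<omega>. 0 \<partial>M)"
          by (rule nn_integral_mono)
        then show ?thesis by simp
      next
        case False
        then have "?T = \<infinity>" using aR by (simp add: ennreal_mult_eq_top_iff ennreal_eq_0_iff)
        then show ?thesis by (simp only: infinity_ennreal_def top_greatest)
      qed
    qed
    then show ?thesis
      unfolding expected_sup_increment_def by (intro SUP_least) simp
  qed
qed

end
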